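(* Let $\mathcal G$ be a locally compact étale groupoid (not necessarily Hausdorff) with Hausdorff unit space $\mathcal G^{(0)}$ and let $p\colon\mathcal L\to\mathcal G$ be a Fell line bundle. Then, for every representation $\pi$ of $\Gamma_c(\mathcal G,\mathcal L)$ on a pre-Hilbert space, we have $\|\pi(\eta)\|\le\|\eta\|_I$ for all $\eta\in\Gamma_c(\mathcal G,\mathcal L)$, where $$\|\eta\|_I:=\max\Big\{\sup_{x\in\mathcal G^{(0)}}\sum_{g\in\mathcal G_x}\|\eta(g)\|,\ \sup_{x\in\mathcal G^{(0)}}\sum_{g\in\mathcal G^x}\|\eta(g)\|\Big\}.$$
   Context: **Groupoids.** A locally compact étale groupoid $\mathcal G$ is a locally compact topological groupoid whose range and source maps $r(g)=gg^{-1}$, $s(g)=g^{-1}g$ are local homeomorphisms onto the unit space $\mathcal G^{(0)}$. $\mathcal G^{(0)}$ is Hausdorff in the relative topology; $\mathcal G$ need not be Hausdorff. Put $\mathcal G^x=r^{-1}(x)$, $\mathcal G_x=s^{-1}(x)$. **Fell line bundles.** A Banach line bundle over $\mathcal G$ is a topological space $\mathcal L$ with an open continuous surjection $p\colon\mathcal L\to\mathcal G$ and a one-dimensional complex normed space structure on each fiber $\mathcal L_g=p^{-1}(g)$, such that fiberwise addition, scalar multiplication and the norm are continuous, and any net $(a_i)$ in $\mathcal L$ with $\|a_i\|\to0$ and $p(a_i)\to g$ converges to the zero of $\mathcal L_g$ (such bundles are automatically locally trivial). It is a Fell line bundle if in addition there are bilinear maps $\mathcal L_g\times\mathcal L_h\to\mathcal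 L_{gh}$, $(a,b)\mapsto ab$ (for $s(g)=r(h)$), and antilinear maps $*\colon\mathcal L_g\to\mathcal L_{g^{-1}}$ such that: multiplication is continuous, associative and $\|ab\|=\|a\|\|b\|$; the involution is continuous, involutive, antimultiplicative and $\|a^*\|=\|a\|$; and $a^*a\ge0$ for all $a\in\mathcal L$, where $a^*a\in\mathcal L_{s(p(a))}$ and for every unit $x$ the one-dimensional C$^*$-algebra $\mathcal L_x$ is identified with $\mathbb C$. **$\Gamma_c(\mathcal G,\mathcal L)$.** For open Hausdorff $U\subset\mathcal G$, $\Gamma_c(U,\mathcal L)$ is the space of compactly supported continuous sections of $\mathcal L|_U=p^{-1}(U)$, extended by zero to $\mathcal G$. $\Gamma_c(\mathcal G,\mathcal L)$ is the linear span of all such spaces. It is a $*$-algebra with $(\eta_1*\eta_2)(g)=\sum_{h\in\mathcal G^{r(g)}}\eta_1(h)\eta_2(h^{-1}g)$ and $\eta^*(g)=\eta(g^{-1})^*$. **Representations.** A representation of $\Gamma_c(\mathcal G,\mathcal L)$ on a pre-Hilbert space $H$ is an algebra homomorphism $\pi$ into the algebra of all, not a priori bounded, linear operators $H\to H$ such that $(\pi(\eta)\xi,\zeta)=(\xi,\pi(\eta^* )\zeta)$ for all $\eta\in\Gamma_c(\mathcal G,\mathcal L)$ and $\xi,\zeta\in H$. *)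

theory Defs
  imports "HOL-Analysis.Analysis" "HOL-Algebra.FiniteProduct"
begin

section \<open>Locally compact etale groupoids\<close>

text \<open>
  Arrows and bundle elements range over whole types of class \<^class>\<open>topological_space\<close>.
  The product of a groupoid and the multiplication of a Fell bundle are partial; they are
  represented by total functions which are constrained only on composable pairs.
\<close>

record 'g groupoid_struct =
  gmul :: "'g \<Rightarrow> 'g \<Rightarrow> 'g"
  ginv :: "'g \<Rightarrow> 'g"

definition rng :: "('g, 'z) groupoid_struct_scheme \<Rightarrow> 'g \<Rightarrow> 'g" where
  "rng G g = gmul G g (ginv G g)"

definition src :: "('g, 'z) groupoid_struct_scheme \<Rightarrow> 'g \<Rightarrow> 'g" where
  "src G g = gmul G (ginv G g) g"

definition gunits :: "('g, 'z) groupoid_struct_scheme \<Rightarrow> 'g set" where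
  "gunits G = range (rng G)"

definition composable :: "('g, 'z) groupoid_struct_scheme \<Rightarrow> 'g \<Rightarrow> 'g \<Rightarrow> bool" where
  "composable G g h \<longleftrightarrow> src G g = rng G h"

locale algebraic_groupoid =
  fixes G :: "'g groupoid_struct"
  assumes ginv_ginv: "ginv G (ginv G g) = g"
    and rng_gmul: "composable G g h \<Longrightarrow> rng G (gmul G g h) = rng G g"
    and src_gmul: "composable G g h \<Longrightarrow> src G (gmul G g h) = src G h"
    and gmul_assoc: "composable G g h \<Longrightarrow> composable G h k \<Longrightarrow>
          gmul G (gmul G g h) k = gmul G g (gmul G h k)"
    and gmul_rng: "gmul G (rng G g) g = g"
    and gmul_src: "gmul G g (src G g) = g"

definition local_homeomorphism_onto ::
    "('a::topological_space \<Rightarrow> 'b::topological_space) \<Rightarrow> 'b set \<Rightarrow> bool" where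
  "local_homeomorphism_onto f T \<longleftrightarrow> range f = T \<and>
     (\<forall>x. \<exists>U q. open U \<and> x \<in> U \<and> openin (top_of_set T) (f ` U) \<and> homeomorphism U (f ` U) f q)"

locale locally_compact_etale_groupoid = algebraic_groupoid G
  for G :: "'g::topological_space groupoid_struct" +
  assumes continuous_gmul: "continuous_on {(g, h). composable G g h} (\<lambda>(g, h). gmul G g h)"
    and continuous_ginv: "continuous_on UNIV (ginv G)"
    and locally_compact: "locally_compact_space (euclidean :: 'g topology)"
    and rng_local_homeomorphism: "local_homeomorphism_onto (rng G) (gunits G)"
    and src_local_homeomorphism: "local_homeomorphism_onto (src G) (gunits G)"
    and Hausdorff_units: "Hausdorff_space (top_of_set (gunits G))"

section \<open>Fell line bundles\<close>

record ('g, 'l) line_bundle_struct =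
  proj :: "'l \<Rightarrow> 'g"
  lzero :: "'g \<Rightarrow> 'l"
  ladd :: "'l \<Rightarrow> 'l \<Rightarrow> 'l"
  lscale :: "complex \<Rightarrow> 'l \<Rightarrow> 'l"
  lnorm :: "'l \<Rightarrow> real"

record ('g, 'l) fell_bundle_struct = "('g, 'l) line_bundle_struct" +
  lmul :: "'l \<Rightarrow> 'l \<Rightarrow> 'l"
  lstar :: "'l \<Rightarrow> 'l"

definition fibre :: "('g, 'l, 'z) line_bundle_struct_scheme \<Rightarrow> 'g \<Rightarrow> 'l set" where
  "fibre L g = {a. proj L a = g}"

text \<open>
  The additive group of a fibre. Addition is only meaningful inside a fibre, so fibrewise finite
  sums are taken with the carrier-based \<^const>\<open>finprod\<close>, which for this (multiplicatively
  written) monoid record is the sum.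
\<close>

definition fibre_group :: "('g, 'l, 'z) line_bundle_struct_scheme \<Rightarrow> 'g \<Rightarrow> 'l monoid" where
  "fibre_group L g = \<lparr>carrier = fibre L g, mult = ladd L, one = lzero L g\<rparr>"

text \<open>
  In \<open>small_norm_limit\<close>, nets in the total space are expressed by filters on it: a net gives the
  filter generated by its tails, and every filter arises in this way.
\<close>

locale banach_line_bundle =
  fixes L :: "('g::topological_space, 'l::topological_space, 'z) line_bundle_struct_scheme"
  assumes proj_continuous: "continuous_on UNIV (proj L)"
    and proj_open: "open W \<Longrightarrow> open (proj L ` W)"
    and proj_surj: "surj (proj L)"
    and fibre_comm_group: "comm_group (fibre_group L g)"
    and proj_lscale: "proj L (lscale L c a) = proj L a"
    and lscale_ladd: "proj L a = proj L b \<Longrightarrow>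
          lscale L c (ladd L a b) = ladd L (lscale L c a) (lscale L c b)"
    and lscale_add: "lscale L (c + d) a = ladd L (lscale L c a) (lscale L d a)"
    and lscale_lscale: "lscale L c (lscale L d a) = lscale L (c * d) a"
    and lscale_one: "lscale L 1 a = a"
    and fibre_one_dim: "\<exists>a \<in> fibre L g. a \<noteq> lzero L g \<and> fibre L g = range (\<lambda>c. lscale L c a)"
    and lnorm_nonneg: "0 \<le> lnorm L a"
    and lnorm_eq_0: "lnorm L a = 0 \<longleftrightarrow> a = lzero L (proj L a)"
    and lnorm_lscale: "lnorm L (lscale L c a) = cmod c * lnorm L a"
    and lnorm_triangle: "proj L a = proj L b \<Longrightarrow> lnorm L (ladd L a b) \<le> lnorm L a + lnorm L b"
    and continuous_ladd: "continuous_on {(a, b). proj L a = proj L b} (\<lambda>(a, b). ladd L a b)"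
    and continuous_lscale: "continuous_on UNIV (\<lambda>(c, a). lscale L c a)"
    and continuous_lnorm: "continuous_on UNIV (lnorm L)"
    and small_norm_limit: "(lnorm L \<longlongrightarrow> 0) F \<Longrightarrow> (proj L \<longlongrightarrow> g) F \<Longrightarrow> ((\<lambda>a. a) \<longlongrightarrow> lzero L g) F"

text \<open>
  The identification of the fibre over a unit with the complex numbers as a *-algebra. For a Fell
  line bundle it exists and is unique: the nonzero idempotent of the fibre goes to 1.
\<close>

definition unit_fibre_iso ::
    "('g, 'l, 'z) fell_bundle_struct_scheme \<Rightarrow> 'g \<Rightarrow> ('l \<Rightarrow> complex) \<Rightarrow> bool" where
  "unit_fibre_iso L x \<phi> \<longleftrightarrow> bij_betw \<phi> (fibre L x) UNIV \<and>
     (\<forall>a \<in> fibre L x. \<forall>b \<in> fibre L x. \<phi> (ladd L a b) = \<phi> a + \<phi> b \<and> \<phi> (lmul L a b) = \<phi> a * \<phi> b) \<and>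
     (\<forall>a \<in> fibre L x. \<forall>c. \<phi> (lscale L c a) = c * \<phi> a) \<and>
     (\<forall>a \<in> fibre L x. \<phi> (lstar L a) = cnj (\<phi> a))"

locale fell_line_bundle = locally_compact_etale_groupoid G + banach_line_bundle L
  for G :: "'g::topological_space groupoid_struct"
    and L :: "('g, 'l::topological_space) fell_bundle_struct" +
  assumes proj_lmul: "composable G (proj L a) (proj L b) \<Longrightarrow>
        proj L (lmul L a b) = gmul G (proj L a) (proj L b)"
    and lmul_ladd_left: "proj L a = proj L a' \<Longrightarrow> composable G (proj L a) (proj L b) \<Longrightarrow>
          lmul L (ladd L a a') b = ladd L (lmul L a b) (lmul L a' b)"
    and lmul_ladd_right: "proj L b = proj L b' \<Longrightarrow> composable G (proj L a) (proj L b) \<Longrightarrow>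
          lmul L a (ladd L b b') = ladd L (lmul L a b) (lmul L a b')"
    and lmul_lscale_left: "composable G (proj L a) (proj L b) \<Longrightarrow>
          lmul L (lscale L c a) b = lscale L c (lmul L a b)"
    and lmul_lscale_right: "composable G (proj L a) (proj L b) \<Longrightarrow>
          lmul L a (lscale L c b) = lscale L c (lmul L a b)"
    and continuous_lmul:
          "continuous_on {(a, b). composable G (proj L a) (proj L b)} (\<lambda>(a, b). lmul L a b)"
    and lmul_assoc: "composable G (proj L a) (proj L b) \<Longrightarrow> composable G (proj L b) (proj L d) \<Longrightarrow>
          lmul L (lmul L a b) d = lmul L a (lmul L b d)"
    and lnorm_lmul: "composable G (proj L a) (proj L b) \<Longrightarrow> lnorm L (lmul L a b) = lnorm L a * lnorm L b"
    and proj_lstar: "proj L (lstar L a) = ginv G (proj L a)"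
    and lstar_ladd: "proj L a = proj L b \<Longrightarrow> lstar L (ladd L a b) = ladd L (lstar L a) (lstar L b)"
    and lstar_lscale: "lstar L (lscale L c a) = lscale L (cnj c) (lstar L a)"
    and continuous_lstar: "continuous_on UNIV (lstar L)"
    and lstar_lstar: "lstar L (lstar L a) = a"
    and lstar_lmul: "composable G (proj L a) (proj L b) \<Longrightarrow>
          lstar L (lmul L a b) = lmul L (lstar L b) (lstar L a)"
    and lnorm_lstar: "lnorm L (lstar L a) = lnorm L a"
    and lstar_lmul_self_nonneg: "\<exists>\<phi>. unit_fibre_iso L (src G (proj L a)) \<phi> \<and>
          \<phi> (lmul L (lstar L a) a) \<in> \<real>\<^sub>\<ge>\<^sub>0"

section \<open>The *-algebra of compactly supported sections\<close>

definition Gamma_c_on ::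
    "('g::topological_space, 'l::topological_space, 'z) line_bundle_struct_scheme \<Rightarrow> 'g set \<Rightarrow>
     ('g \<Rightarrow> 'l) set" where
  "Gamma_c_on L U = {\<eta>. (\<forall>g. \<eta> g \<in> fibre L g) \<and> continuous_on U \<eta> \<and>
     compact (top_of_set U closure_of {g \<in> U. \<eta> g \<noteq> lzero L g}) \<and>
     (\<forall>g. g \<notin> U \<longrightarrow> \<eta> g = lzero L g)}"

definition section_add ::
    "('g, 'l, 'z) line_bundle_struct_scheme \<Rightarrow> ('g \<Rightarrow> 'l) \<Rightarrow> ('g \<Rightarrow> 'l) \<Rightarrow> 'g \<Rightarrow> 'l" where
  "section_add L \<eta> \<zeta> = (\<lambda>g. ladd L (\<eta> g) (\<zeta> g))"

definition section_scale ::
    "('g, 'l, 'z) line_bundle_struct_scheme \<Rightarrow> complex \<Rightarrow> ('g \<Rightarrow> 'l) \<Rightarrow> 'g \<Rightarrow> 'l" where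
  "section_scale L c \<eta> = (\<lambda>g. lscale L c (\<eta> g))"

text \<open>The linear span; the zero section belongs to it since \<open>U\<close> may be empty.\<close>

inductive_set Gamma_c ::
    "('g::topological_space, 'l::topological_space, 'z) line_bundle_struct_scheme \<Rightarrow> ('g \<Rightarrow> 'l) set"
  for L where
  base: "open U \<Longrightarrow> Hausdorff_space (top_of_set U) \<Longrightarrow> \<eta> \<in> Gamma_c_on L U \<Longrightarrow> \<eta> \<in> Gamma_c L"
| add: "\<eta> \<in> Gamma_c L \<Longrightarrow> \<zeta> \<in> Gamma_c L \<Longrightarrow> section_add L \<eta> \<zeta> \<in> Gamma_c L"
| scale: "\<eta> \<in> Gamma_c L \<Longrightarrow> section_scale L c \<eta> \<in> Gamma_c L"

text \<open>
  The convolution sum is restricted to its nonzero terms, of which there are finitely many for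
  sections in \<^const>\<open>Gamma_c\<close>, because \<^const>\<open>finprod\<close> is only meaningful over finite sets.
\<close>

definition convolution ::
    "'g groupoid_struct \<Rightarrow> ('g, 'l) fell_bundle_struct \<Rightarrow> ('g \<Rightarrow> 'l) \<Rightarrow> ('g \<Rightarrow> 'l) \<Rightarrow> 'g \<Rightarrow> 'l" where
  "convolution G L \<eta>1 \<eta>2 = (\<lambda>g.
     let t = (\<lambda>h. lmul L (\<eta>1 h) (\<eta>2 (gmul G (ginv G h) g)))
     in finprod (fibre_group L g) t {h. rng G h = rng G g \<and> t h \<noteq> lzero L g})"

definition section_star ::
    "'g groupoid_struct \<Rightarrow> ('g, 'l) fell_bundle_struct \<Rightarrow> ('g \<Rightarrow> 'l) \<Rightarrow> 'g \<Rightarrow> 'l" where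
  "section_star G L \<eta> = (\<lambda>g. lstar L (\<eta> (ginv G g)))"

text \<open>The I-norm is formed in \<open>[0, \<infinity>]\<close>, where infinite sums and suprema always exist.\<close>

definition I_norm ::
    "'g groupoid_struct \<Rightarrow> ('g, 'l) fell_bundle_struct \<Rightarrow> ('g \<Rightarrow> 'l) \<Rightarrow> ennreal" where
  "I_norm G L \<eta> = max
     (SUP x \<in> gunits G. \<Sum>\<^sub>\<infinity> g \<in> {g. src G g = x}. ennreal (lnorm L (\<eta> g)))
     (SUP x \<in> gunits G. \<Sum>\<^sub>\<infinity> g \<in> {g. rng G g = x}. ennreal (lnorm L (\<eta> g)))"

section \<open>Representations on pre-Hilbert spaces\<close>

locale pre_hilbert_space = vector_space scaleC
  for scaleC :: "complex \<Rightarrow> 'h::ab_group_add \<Rightarrow> 'h" +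
  fixes ip :: "'h \<Rightarrow> 'h \<Rightarrow> complex"
  assumes ip_add_left: "ip (\<xi> + \<xi>') \<zeta> = ip \<xi> \<zeta> + ip \<xi>' \<zeta>"
    and ip_scale_left: "ip (scaleC c \<xi>) \<zeta> = c * ip \<xi> \<zeta>"
    and ip_cnj: "ip \<zeta> \<xi> = cnj (ip \<xi> \<zeta>)"
    and ip_nonneg: "ip \<xi> \<xi> \<in> \<real>\<^sub>\<ge>\<^sub>0"
    and ip_definite: "ip \<xi> \<xi> = 0 \<Longrightarrow> \<xi> = 0"

definition ip_norm :: "('h \<Rightarrow> 'h \<Rightarrow> complex) \<Rightarrow> 'h \<Rightarrow> real" where
  "ip_norm ip \<xi> = sqrt (Re (ip \<xi> \<xi>))"

text \<open>The operator norm of a not necessarily bounded operator, with values in \<open>[0, \<infinity>]\<close>.\<close>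

definition op_norm :: "('h \<Rightarrow> 'h \<Rightarrow> complex) \<Rightarrow> ('h \<Rightarrow> 'h) \<Rightarrow> ennreal" where
  "op_norm ip T = (SUP \<xi> \<in> {\<xi>. ip_norm ip \<xi> \<le> 1}. ennreal (ip_norm ip (T \<xi>)))"

locale Gamma_c_representation = fell_line_bundle G L + pre_hilbert_space scaleC ip
  for G :: "'g::topological_space groupoid_struct"
    and L :: "('g, 'l::topological_space) fell_bundle_struct"
    and scaleC :: "complex \<Rightarrow> 'h::ab_group_add \<Rightarrow> 'h"
    and ip :: "'h \<Rightarrow> 'h \<Rightarrow> complex" +
  fixes \<pi> :: "('g \<Rightarrow> 'l) \<Rightarrow> 'h \<Rightarrow> 'h"
  assumes rep_linear: "\<eta> \<in> Gamma_c L \<Longrightarrow> Vector_Spaces.linear scaleC scaleC (\<pi> \<eta>)"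
    and rep_add: "\<eta> \<in> Gamma_c L \<Longrightarrow> \<zeta> \<in> Gamma_c L \<Longrightarrow> \<pi> (section_add L \<eta> \<zeta>) \<xi> = \<pi> \<eta> \<xi> + \<pi> \<zeta> \<xi>"
    and rep_scale: "\<eta> \<in> Gamma_c L \<Longrightarrow> \<pi> (section_scale L c \<eta>) \<xi> = scaleC c (\<pi> \<eta> \<xi>)"
    and rep_convolution: "\<eta> \<in> Gamma_c L \<Longrightarrow> \<zeta> \<in> Gamma_c L \<Longrightarrow>
          \<pi> (convolution G L \<eta> \<zeta>) \<xi> = \<pi> \<eta> (\<pi> \<zeta> \<xi>)"
    and rep_star: "\<eta> \<in> Gamma_c L \<Longrightarrow> ip (\<pi> \<eta> \<xi>) \<xi>' = ip \<xi> (\<pi> (section_star G L \<eta>) \<xi>')"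

end

theory Submission
  imports Defs
begin

text \<open>
  Write \<open>\<eta> = \<Sum>\<^sub>i f\<^sub>i\<close> with \<open>f\<^sub>i\<close> supported in bisections \<open>U\<^sub>i\<close>, and let \<open>\<mu>\<^sub>\<xi>(a) = (\<xi>, \<pi>(a)\<xi>)\<close>, a positive
  functional of norm at most \<open>\<parallel>\<xi>\<parallel>\<^sup>2\<close> on compactly supported functions on the unit space. Factoring
  each \<open>f\<^sub>i\<close> through \<open>\<surd>\<bar>f\<^sub>i\<bar>\<close> gives \<open>2 \<bar>(\<pi>(\<eta>)\<xi>, \<zeta>)\<bar> \<le> \<Sum>\<^sub>i \<mu>\<^sub>\<xi>(s\<^sub>*\<bar>f\<^sub>i\<bar>) + \<mu>\<^sub>\<zeta>(r\<^sub>*\<bar>f\<^sub>i\<bar>)\<close>. This cost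
  exceeds what \<open>\<parallel>\<eta>\<parallel>\<^sub>I\<close> allows only because of cancellation between the \<open>f\<^sub>i\<close> on the overlaps of
  the \<open>U\<^sub>i\<close>. For a decomposition of nearly minimal cost the cancellation is negligible, since
  otherwise moving mass on an overlap from some \<open>f\<^sub>i\<close> to another would lower the cost; a compactness
  argument turns this into the bound \<open>2 \<parallel>\<eta>\<parallel>\<^sub>I + \<epsilon>\<close>. Positive functionals and continuous cutoffs
  take the place of measures throughout.
\<close>

text \<open>For Hausdorff \<open>G\<close> a partition of unity gives pieces
  \<open>\<phi>_i \<eta>\<close> whose norms add up to the norm of \<eta>, and the estimate is
  immediate. Without Hausdorffness \<eta> need not be continuous on a given bisection, so such
  pieces are not admissible and the cancellation cannot be removed outright. Nor need the infimum of
  the cost be attained; it is enough that, within \<epsilon> of it, no transfer gains more than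
  \<epsilon>. The minimised quantity adds the source cost seen by \<xi> and the range cost seen by
  \<zeta>, so that a single decomposition has small cancellation for both. Each of the two is then
  at most about \<open>M\<close>, a common bound for all fibre sums, and the factor 1/2 of the
  arithmetic-mean inequality turns them into one \<open>M\<close>. Compactness is needed because the
  cancellation lives on open overlaps and need not vanish towards their boundaries: its fibre sums
  may be discontinuous on the unit space, and a functional defined on \<open>Cc\<close> can be
  applied only after they are cut off.\<close>

section \<open>Compactly supported functions and local homeomorphisms\<close>

text \<open>Continuity is asked on \<open>U\<close> only: in a non-Hausdorff space the extension by
  zero may be discontinuous at points outside \<open>U\<close>.\<close>

definition Cc :: "'a::topological_space set \<Rightarrow> ('a \<Rightarrow> real) set" where
  "Cc U = {h. continuous_on U h \<and> (\<exists>K. compact K \<and> K \<subseteq> U \<and> (\<forall>x. x \<notin> K \<longrightarrow> h x = 0))}"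

text \<open>A plain sum over the fibre involves no inverse of \<open>t\<close>, so linearity holds
  without hypotheses. Where \<open>t\<close> is injective on \<open>U\<close> it has at most one
  term.\<close>

definition pushforward :: "('a \<Rightarrow> 'b) \<Rightarrow> 'a set \<Rightarrow> ('a \<Rightarrow> real) \<Rightarrow> 'b \<Rightarrow> real" where
  "pushforward t U h x = (\<Sum>g \<in> {g \<in> U. t g = x}. h g)"

lemma open_Diff_compact:
  assumes "open U" "Hausdorff_space (top_of_set U)" "compact K" "K \<subseteq> U"
  shows "open (U - K)"
proof -
  have "closedin (top_of_set U) K"
    using assms by (intro compactin_imp_closedin) (auto simp: compactin_subtopology)
  then have "openin (top_of_set U) (U - K)"
    by (metis openin_diff openin_topspace topspace_euclidean_subtopology)
  then show ?thesis
    using assms(1) openin_open_trans by blast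
qed

lemma CcI:
  assumes "continuous_on U h" "compact K" "K \<subseteq> U" "\<And>x. x \<notin> K \<Longrightarrow> h x = 0"
  shows "h \<in> Cc U"
  using assms unfolding Cc_def by blast

lemma Cc_continuous: "h \<in> Cc U \<Longrightarrow> continuous_on U h"
  by (simp add: Cc_def)

lemma Cc_outside: "h \<in> Cc U \<Longrightarrow> g \<notin> U \<Longrightarrow> h g = 0"
  unfolding Cc_def by blast

lemma Cc_mult_continuous:
  assumes "h \<in> Cc U" "continuous_on U k"
  shows "(\<lambda>g. h g * k g) \<in> Cc U" "(\<lambda>g. k g * h g) \<in> Cc U"
proof -
  obtain K where K: "compact K" "K \<subseteq> U" "\<And>x. x \<notin> K \<Longrightarrow> h x = 0"
    using assms(1) unfolding Cc_def by blast
  show "(\<lambda>g. h g * k g) \<in> Cc U" "(\<lambda>g. k g * h g) \<in> Cc U"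
    by (rule CcI[OF _ K(1,2)];
        simp add: K(3) continuous_on_mult Cc_continuous[OF assms(1)] assms(2))+
qed

lemma Cc_compose:
  assumes "h \<in> Cc U" "continuous_on UNIV \<phi>" "\<phi> 0 = 0"
  shows "(\<lambda>g. \<phi> (h g)) \<in> Cc U"
proof -
  obtain K where K: "compact K" "K \<subseteq> U" "\<And>x. x \<notin> K \<Longrightarrow> h x = 0"
    using assms(1) unfolding Cc_def by blast
  have "continuous_on U (\<lambda>g. \<phi> (h g))"
    by (rule continuous_on_compose2[OF assms(2) Cc_continuous[OF assms(1)]]) simp
  then show ?thesis
    by (rule CcI[OF _ K(1,2)]) (simp add: K(3) assms(3))
qed

lemma Cc_combine:
  assumes "h \<in> Cc U" "k \<in> Cc U" "continuous_on UNIV (\<lambda>(a, b). \<phi> a b)" "\<phi> 0 0 = 0"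
  shows "(\<lambda>g. \<phi> (h g) (k g)) \<in> Cc U"
proof -
  obtain K where K: "compact K" "K \<subseteq> U" "\<And>x. x \<notin> K \<Longrightarrow> h x = 0"
    using assms(1) unfolding Cc_def by blast
  obtain K' where K': "compact K'" "K' \<subseteq> U" "\<And>x. x \<notin> K' \<Longrightarrow> k x = 0"
    using assms(2) unfolding Cc_def by blast
  have "continuous_on U (\<lambda>g. (\<lambda>(a, b). \<phi> a b) (h g, k g))"
    by (rule continuous_on_compose2[OF assms(3)])
       (simp_all add: continuous_on_Pair Cc_continuous assms(1,2))
  then show ?thesis
    by (intro CcI[of _ _ "K \<union> K'"]) (use K K' assms(4) in auto)
qed

lemma Cc_add: "h \<in> Cc U \<Longrightarrow> k \<in> Cc U \<Longrightarrow> (\<lambda>g. h g + k g) \<in> Cc U"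
  by (rule Cc_combine) (simp_all add: split_beta continuous_on_add continuous_on_diff continuous_on_mult continuous_on_fst continuous_on_snd)

lemma Cc_diff: "h \<in> Cc U \<Longrightarrow> k \<in> Cc U \<Longrightarrow> (\<lambda>g. h g - k g) \<in> Cc U"
  by (rule Cc_combine) (simp_all add: split_beta continuous_on_add continuous_on_diff continuous_on_mult continuous_on_fst continuous_on_snd)

lemma Cc_mult: "h \<in> Cc U \<Longrightarrow> k \<in> Cc U \<Longrightarrow> (\<lambda>g. h g * k g) \<in> Cc U"
  by (rule Cc_combine) (simp_all add: split_beta continuous_on_add continuous_on_diff continuous_on_mult continuous_on_fst continuous_on_snd)

lemma Cc_cmult: "h \<in> Cc U \<Longrightarrow> (\<lambda>g. c * h g) \<in> Cc U"
  by (rule Cc_compose) (simp_all add: continuous_on_mult)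

lemma Cc_zero: "(\<lambda>g. 0) \<in> Cc U"
  by (rule CcI[of _ _ "{}"]) auto

lemma Cc_sum: "(\<And>i. i \<in> I \<Longrightarrow> h i \<in> Cc U) \<Longrightarrow> (\<lambda>g. \<Sum>i\<in>I. h i g) \<in> Cc U"
  by (induction I rule: infinite_finite_induct) (auto intro: Cc_zero Cc_add)

text \<open>The compact \<open>K\<close> is closed in the Hausdorff set \<open>U\<close>, so
  \<open>V\<close> and \<open>U - K\<close> are open, cover \<open>U\<close>, and \<open>h\<close>
  is continuous on each.\<close>

lemma Cc_mono:
  assumes "h \<in> Cc V" "open V" "V \<subseteq> U" "open U" "Hausdorff_space (top_of_set U)"
  shows "h \<in> Cc U"
proof -
  obtain K where K: "compact K" "K \<subseteq> V" "\<And>x. x \<notin> K \<Longrightarrow> h x = 0"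
    using assms(1) unfolding Cc_def by blast
  have op: "open (U - K)"
    using assms K open_Diff_compact by blast
  have "continuous_on (U - K) h"
    by (rule continuous_on_eq[of _ "\<lambda>_. 0"]) (auto simp: K(3))
  then have "continuous_on (V \<union> (U - K)) h"
    by (intro continuous_on_open_Un op assms(2) Cc_continuous[OF assms(1)])
  moreover have "V \<union> (U - K) = U"
    using K assms by blast
  ultimately show ?thesis
    using K assms by (intro CcI[of _ _ K]) auto
qed

lemma pushforward_add:
  "pushforward t U (\<lambda>g. h g + k g) x = pushforward t U h x + pushforward t U k x"
  by (simp add: pushforward_def sum.distrib)

lemma pushforward_diff:
  "pushforward t U (\<lambda>g. h g - k g) x = pushforward t U h x - pushforward t U k x"
  by (simp add: pushforward_def sum_subtractf)

lemma pushforward_sum: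
  "pushforward t U (\<lambda>g. \<Sum>i\<in>I. h i g) x = (\<Sum>i\<in>I. pushforward t U (h i) x)"
  unfolding pushforward_def by (rule sum.swap)

lemma pushforward_mono:
  "(\<And>g. g \<in> U \<Longrightarrow> h g \<le> k g) \<Longrightarrow> pushforward t U h x \<le> pushforward t U k x"
  unfolding pushforward_def by (rule sum_mono) auto

lemma pushforward_nonneg: "(\<And>g. g \<in> U \<Longrightarrow> 0 \<le> h g) \<Longrightarrow> 0 \<le> pushforward t U h x"
  unfolding pushforward_def by (rule sum_nonneg) auto

lemma pushforward_at:
  assumes "inj_on t U" "g \<in> U"
  shows "pushforward t U h (t g) = h g"
proof -
  have "{g' \<in> U. t g' = t g} = {g}"
    using assms by (auto dest: inj_onD)
  then show ?thesis
    by (simp add: pushforward_def)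
qed

lemma pushforward_outside: "x \<notin> t ` U \<Longrightarrow> pushforward t U h x = 0"
  unfolding pushforward_def by (rule sum.neutral) auto

lemma inj_on_fibre_finite: "inj_on t U \<Longrightarrow> finite {g \<in> U. t g = x}"
  by (rule finite_imageD[of t]) (auto intro: finite_subset[of _ "{x}"] inj_on_subset)

lemma pushforward_subset:
  assumes "inj_on t U" "V \<subseteq> U" "\<And>g. g \<notin> V \<Longrightarrow> h g = 0"
  shows "pushforward t V h x = pushforward t U h x"
  unfolding pushforward_def
  by (rule sum.mono_neutral_left) (use assms inj_on_fibre_finite in auto)

text \<open>Source and range both satisfy these axioms, so slices are treated once for the two. The
  base is Hausdorff even when the total space is not.\<close>

locale etale_map =
  fixes t :: "'a::topological_space \<Rightarrow> 'b::topological_space" and X :: "'b set"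
  assumes open_base: "open X"
    and Hausdorff_base: "Hausdorff_space (top_of_set X)"
    and locally_compact_base: "locally_compact_space (top_of_set X)"
    and continuous: "continuous_on UNIV t"
    and open_map: "open W \<Longrightarrow> open (t ` W)"
    and into_base: "t g \<in> X"
begin

lemma slice_homeomorphism:
  assumes "open U" "inj_on t U"
  shows "homeomorphism U (t ` U) t (inv_into U t)"
proof -
  obtain q where q: "homeomorphism U (t ` U) t q"
  proof (rule homeomorphism_injective_open_map[of U t "t ` U"])
    show "continuous_on U t"
      using continuous continuous_on_subset by blast
    show "openin (top_of_set (t ` U)) (t ` T)" if "openin (top_of_set U) T" for T
    proof -
      have "open (t ` T)"
        using that assms(1) open_map openin_open_trans by blast
      moreover have "T \<subseteq> U"
        using that openin_imp_subset by blast
      ultimately show ?thesis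
        by (meson image_mono open_subset)
    qed
  qed (use assms in auto)
  have "continuous_on (t ` U) (inv_into U t)"
    by (rule continuous_on_eq[of _ q]) (use q assms in \<open>auto simp: homeomorphism_def\<close>)
  then show ?thesis
    using q assms by (auto simp: homeomorphism_def)
qed

lemma slice_Hausdorff:
  assumes "open U" "inj_on t U"
  shows "Hausdorff_space (top_of_set U)"
proof -
  have "continuous_map (top_of_set U) (top_of_set X) t"
    using continuous into_base by (auto simp: continuous_map_in_subtopology intro: continuous_on_subset)
  then show ?thesis
    by (rule Hausdorff_space_injective_preimage[OF Hausdorff_base]) (simp add: assms)
qed

text \<open>On the image of \<open>U\<close> the fibre sum is \<open>h\<close> composed with the
  inverse of \<open>t\<close>; off the image of \<open>K\<close> it is zero. The base being
  Hausdorff, these are two open pieces covering \<open>X\<close>.\<close>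

lemma pushforward_Cc:
  assumes "open U" "inj_on t U" "h \<in> Cc U"
  shows "pushforward t U h \<in> Cc X"
proof -
  obtain K where K: "compact K" "K \<subseteq> U" "\<And>x. x \<notin> K \<Longrightarrow> h x = 0"
    using assms(3) unfolding Cc_def by blast
  let ?p = "pushforward t U h"
  have cK: "compact (t ` K)"
    using K(1) continuous by (meson compact_continuous_image continuous_on_subset subset_UNIV)
  have zero: "?p x = 0" if "x \<notin> t ` K" for x
    unfolding pushforward_def by (rule sum.neutral) (use that K in auto)
  have hom: "homeomorphism U (t ` U) t (inv_into U t)"
    by (rule slice_homeomorphism) fact+
  have "continuous_on (t ` U) (h \<circ> inv_into U t)"
    using hom Cc_continuous[OF assms(3)]
    by (intro continuous_on_compose) (auto simp: homeomorphism_def)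
  then have "continuous_on (t ` U) ?p"
    by (rule continuous_on_eq) (use assms(2) in \<open>auto simp: pushforward_at\<close>)
  moreover have "open (X - t ` K)"
    using open_Diff_compact[OF open_base Hausdorff_base cK] into_base by blast
  moreover have "continuous_on (X - t ` K) ?p"
    by (rule continuous_on_eq[of _ "\<lambda>_. 0"]) (auto simp: zero)
  ultimately have "continuous_on (t ` U \<union> (X - t ` K)) ?p"
    by (intro continuous_on_open_Un open_map assms)
  moreover have "t ` U \<union> (X - t ` K) = X"
    using K into_base by blast
  ultimately show ?thesis
    by (intro CcI[OF _ cK]) (use zero into_base in auto)
qed

lemma base_bump:
  assumes "open W" "x \<in> W" "W \<subseteq> X"
  obtains b V where "b \<in> Cc W" "\<And>y. 0 \<le> b y" "\<And>y. b y \<le> 1" "open V" "x \<in> V" "\<And>y. y \<in> V \<Longrightarrow> b y = 1"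
proof -
  let ?X = "top_of_set X"
  have "neighbourhood_base_of (compactin ?X) ?X"
    using locally_compact_space_neighbourhood_base Hausdorff_base locally_compact_base by blast
  moreover have "openin ?X W"
    using assms by (simp add: open_subset)
  ultimately obtain W0 K where W0: "openin ?X W0" "compactin ?X K" "x \<in> W0" "W0 \<subseteq> K" "K \<subseteq> W"
    unfolding neighbourhood_base_of using assms(2) by metis
  have K: "compact K"
    using W0(2) by (simp add: compactin_subtopology)
  have oW0: "open W0"
    using W0(1) open_base openin_open_trans by blast
  have "completely_regular_space ?X"
    using locally_compact_regular_imp_completely_regular_space locally_compact_base Hausdorff_base
    by blast
  moreover have "closedin ?X (X - W0)"
    using W0(1) by (metis closedin_diff closedin_topspace topspace_euclidean_subtopology)
  ultimately obtain f :: "'b \<Rightarrow> real" where f: "continuous_map ?X (top_of_set {0..1}) f" "f x = 0"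
      "f ` (X - W0) \<subseteq> {1}"
    unfolding completely_regular_space_def using W0(3) assms(2,3)
    by (elim allE[of _ "X - W0"] allE[of _ x]) auto
  have fc: "continuous_on X f" and f01: "\<And>y. y \<in> X \<Longrightarrow> f y \<in> {0..1}"
    using f(1) by (auto simp: continuous_map_in_subtopology)
  \<comment> \<open>Truncating \<open>2 * (1 - f)\<close> at 1 gives the value 1 on the whole open
    set where \<open>f < 1/2\<close>, not just at \<open>x\<close>. Since \<open>f = 1\<close> off
    \<open>W0\<close>, the function stays continuous, with support inside \<open>K\<close>.\<close>
  let ?b = "\<lambda>y. if y \<in> W0 then min 1 (2 * (1 - f y)) else 0"
  have W0X: "W0 \<subseteq> X"
    using W0(1) openin_imp_subset by blast
  have b_eq: "?b y = min 1 (2 * (1 - f y))" if "y \<in> X" for y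
    using f(3) that by auto
  have cb: "continuous_on X ?b"
    by (rule continuous_on_eq[of _ "\<lambda>y. min 1 (2 * (1 - f y))"])
       (use b_eq in \<open>auto intro!: continuous_intros fc\<close>)
  have "open (X \<inter> f -` {..<1/2})"
    using continuous_open_preimage[OF fc open_base, of "{..<1/2}"] by auto
  then have "open (W0 \<inter> (X \<inter> f -` {..<1/2}))"
    using oW0 by blast
  moreover have "?b \<in> Cc W"
    by (rule CcI[of _ _ K]) (use cb assms(3) K W0 continuous_on_subset in auto)
  moreover have "0 \<le> ?b y" "?b y \<le> 1" for y
    using f01 W0X by (force simp: min_def)+
  ultimately show ?thesis
    using W0 W0X f(2) assms by (intro that[of ?b "W0 \<inter> (X \<inter> f -` {..<1/2})"]) auto
qed

text \<open>A bump on the open image of \<open>U\<close> is pulled back along \<open>t\<close>; the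
  inverse homeomorphism carries its compact support into \<open>U\<close>.\<close>

lemma bump:
  assumes "open U" "inj_on t U" "g \<in> U"
  obtains h V where "h \<in> Cc U" "\<And>y. 0 \<le> h y" "\<And>y. h y \<le> 1" "open V" "g \<in> V" "V \<subseteq> U"
    "\<And>y. y \<in> V \<Longrightarrow> h y = 1"
proof -
  obtain b V where b: "b \<in> Cc (t ` U)" "\<And>y. 0 \<le> b y" "\<And>y. b y \<le> 1" "open V" "t g \<in> V"
      "\<And>y. y \<in> V \<Longrightarrow> b y = 1"
    by (rule base_bump[of "t ` U" "t g"]) (use assms open_map into_base in blast)+
  obtain K where K: "compact K" "K \<subseteq> t ` U" "\<And>x. x \<notin> K \<Longrightarrow> b x = 0"
    using b(1) unfolding Cc_def by blast
  have hom: "homeomorphism U (t ` U) t (inv_into U t)"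
    by (rule slice_homeomorphism) fact+
  have cL: "compact (inv_into U t ` K)"
    using K hom by (metis compact_continuous_image continuous_on_subset homeomorphism_def)
  let ?h = "\<lambda>g. if g \<in> U then b (t g) else 0"
  have tc: "continuous_on U t"
    using continuous continuous_on_subset by blast
  have "continuous_on U (b \<circ> t)"
    by (intro continuous_on_compose tc Cc_continuous b)
  then have ch: "continuous_on U ?h"
    by (rule continuous_on_eq) auto
  have sub: "inv_into U t ` K \<subseteq> U"
    using K(2) by (auto intro: inv_into_into)
  have zero: "?h g = 0" if "g \<notin> inv_into U t ` K" for g
    using that K(3)[of "t g"] assms(2) by (force simp: image_iff)
  have "open (U \<inter> t -` V)"
    using continuous_open_preimage[OF tc assms(1) b(4)] .
  moreover have "?h \<in> Cc U"
    by (rule CcI[OF ch cL sub zero])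
  ultimately show ?thesis
    using b assms by (intro that[of ?h "U \<inter> t -` V"]) auto
qed

text \<open>The functions \<open>D p\<close> need not vanish towards the boundary of
  \<open>V p\<close>, so their fibre sums may be discontinuous. Suitable cutoffs give a continuous
  right-hand side near each single point at the price \<delta>, and compactness of the support of
  \<open>F\<close> reduces to finitely many points.\<close>

lemma Cc_cutoff_approximation:
  fixes V :: "'i \<Rightarrow> 'a set" and D :: "'i \<Rightarrow> 'a \<Rightarrow> real"
  assumes fin: "finite P"
    and opV: "\<And>p. p \<in> P \<Longrightarrow> open (V p)" and injV: "\<And>p. p \<in> P \<Longrightarrow> inj_on t (V p)"
    and contD: "\<And>p. p \<in> P \<Longrightarrow> continuous_on (V p) (D p)"
    and D_nonneg: "\<And>p g. p \<in> P \<Longrightarrow> 0 \<le> D p g"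
    and F: "F \<in> Cc X" and le: "\<And>x. x \<in> X \<Longrightarrow> F x \<le> M + (\<Sum>p\<in>P. pushforward t (V p) (D p) x)"
    and M: "0 \<le> M" and \<delta>: "0 < \<delta>"
  obtains h where "\<And>p. p \<in> P \<Longrightarrow> h p \<in> Cc (V p)" "\<And>p g. 0 \<le> h p g" "\<And>p g. h p g \<le> 1"
    "\<And>x. F x \<le> M + \<delta> + (\<Sum>p\<in>P. pushforward t (V p) (\<lambda>g. h p g * D p g) x)"
proof -
  obtain K where K: "compact K" "K \<subseteq> X" "\<And>x. x \<notin> K \<Longrightarrow> F x = 0"
    using F unfolding Cc_def by blast
  define good where "good h \<longleftrightarrow> (\<forall>p\<in>P. h p \<in> Cc (V p)) \<and> (\<forall>p g. 0 \<le> h p g \<and> h p g \<le> 1)" for h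
  define S where "S h x = (\<Sum>p\<in>P. pushforward t (V p) (\<lambda>g. h p g * D p g) x)" for h x
  have ex: "\<exists>h A. good h \<and> open A \<and> x \<in> A \<and> (\<forall>y\<in>A. F y \<le> M + \<delta> + S h y)" if x: "x \<in> K" for x
  proof -
    \<comment> \<open>Over \<open>x\<close> the set \<open>V p\<close> has at most one point. A
      cutoff equal to 1 there reproduces the whole fibre sum; if there is no such point, zero
      does.\<close>
    have "\<exists>h. h \<in> Cc (V p) \<and> (\<forall>g. 0 \<le> h g \<and> h g \<le> 1) \<and>
        pushforward t (V p) (\<lambda>g. h g * D p g) x = pushforward t (V p) (D p) x" if p: "p \<in> P" for p
    proof (cases "x \<in> t ` V p")
      case True
      then obtain g where g: "g \<in> V p" "x = t g"
        by blast
      obtain h W where "h \<in> Cc (V p)" "\<And>y. 0 \<le> h y" "\<And>y. h y \<le> 1" "open W" "g \<in> W"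
          "\<And>y. y \<in> W \<Longrightarrow> h y = 1"
        using bump[OF opV[OF p] injV[OF p] g(1)] by metis
      then show ?thesis
        using g injV[OF p] by (intro exI[of _ h]) (auto simp: pushforward_at)
    next
      case False
      then show ?thesis
        by (intro exI[of _ "\<lambda>_. 0"]) (auto simp: pushforward_outside Cc_zero)
    qed
    then obtain h where h: "\<And>p. p \<in> P \<Longrightarrow> h p \<in> Cc (V p)" "\<And>p g. p \<in> P \<Longrightarrow> 0 \<le> h p g \<and> h p g \<le> 1"
        "\<And>p. p \<in> P \<Longrightarrow> pushforward t (V p) (\<lambda>g. h p g * D p g) x = pushforward t (V p) (D p) x"
      by metis
    define h' where "h' p = (if p \<in> P then h p else (\<lambda>_. 0))" for p
    have gd: "good h'"
      using h by (auto simp: good_def h'_def)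
    have Sx: "S h' x = (\<Sum>p\<in>P. pushforward t (V p) (D p) x)"
      unfolding S_def by (rule sum.cong) (auto simp: h'_def h(3))
    have "S h' \<in> Cc X"
      unfolding S_def
      by (intro Cc_sum pushforward_Cc opV injV Cc_mult_continuous contD) (use gd in \<open>auto simp: good_def\<close>)
    then have cont: "continuous_on X (\<lambda>y. M + \<delta> + S h' y - F y)"
      by (intro continuous_intros Cc_continuous F)
    \<comment> \<open>The cut-off fibre sums are continuous, so the strict inequality that \<delta>
      provides at \<open>x\<close> persists on an open set.\<close>
    have op: "open (X \<inter> (\<lambda>y. M + \<delta> + S h' y - F y) -` {0<..})"
      using continuous_open_preimage[OF cont open_base, of "{0<..}"] by auto
    have "x \<in> X"
      using x K by blast
    then have "M + \<delta> + S h' x - F x > 0"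
      using le[of x] Sx \<delta> by simp
    with \<open>x \<in> X\<close> gd op show ?thesis
      by (intro exI[of _ h'] exI[of _ "X \<inter> (\<lambda>y. M + \<delta> + S h' y - F y) -` {0<..}"]) auto
  qed
  then obtain H A where HA: "\<And>x. x \<in> K \<Longrightarrow> good (H x)" "\<And>x. x \<in> K \<Longrightarrow> open (A x)"
      "\<And>x. x \<in> K \<Longrightarrow> x \<in> A x" "\<And>x y. x \<in> K \<Longrightarrow> y \<in> A x \<Longrightarrow> F y \<le> M + \<delta> + S (H x) y"
    by metis
  obtain T where T: "T \<subseteq> K" "finite T" "K \<subseteq> (\<Union>x\<in>T. A x)"
    using compactE_image[OF K(1), of K A] HA(2,3) by blast
  have "\<exists>h. good h \<and> (\<forall>x\<in>T. \<forall>p\<in>P. \<forall>g. H x p g \<le> h p g)"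
    using T(2,1)
  proof (induction T rule: finite_induct)
    case empty
    show ?case
      by (intro exI[of _ "\<lambda>_ _. 0"]) (auto simp: good_def Cc_zero)
  next
    case (insert x T)
    then obtain h where h: "good h" "\<forall>x\<in>T. \<forall>p\<in>P. \<forall>g. H x p g \<le> h p g"
      by auto
    have gx: "good (H x)"
      using insert.prems HA(1) by auto
    \<comment> \<open>The maximum, unlike a sum, stays below 1. As \<open>D\<close> is nonnegative,
      enlarging a cutoff only raises the right-hand side of the bound.\<close>
    have "good (\<lambda>p g. max (h p g) (H x p g))"
      using h(1) gx unfolding good_def
      by (auto intro!: Cc_combine[where \<phi> = max] continuous_intros simp: split_beta le_max_iff_disj)
    then show ?case
      using h(2) by (intro exI[of _ "\<lambda>p g. max (h p g) (H x p g)"]) (auto simp: le_max_iff_disj)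
  qed
  then obtain h where h: "good h" "\<And>x p g. x \<in> T \<Longrightarrow> p \<in> P \<Longrightarrow> H x p g \<le> h p g"
    by blast
  show ?thesis
  proof (rule that[of h])
    fix y
    show "F y \<le> M + \<delta> + (\<Sum>p\<in>P. pushforward t (V p) (\<lambda>g. h p g * D p g) y)"
    proof (cases "y \<in> K")
      case True
      then obtain x where x: "x \<in> T" "y \<in> A x"
        using T by blast
      have "F y \<le> M + \<delta> + S (H x) y"
        using HA(4) x T by blast
      also have "S (H x) y \<le> S h y"
        unfolding S_def
        by (intro sum_mono pushforward_mono mult_right_mono h D_nonneg x)
      finally show ?thesis
        by (simp add: S_def)
    next
      case False
      moreover have "0 \<le> S h y"
        unfolding S_def using h(1)
        by (intro sum_nonneg pushforward_nonneg mult_nonneg_nonneg D_nonneg) (auto simp: good_def)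
      ultimately show ?thesis
        using K(3) M \<delta> by (simp add: S_def)
    qed
  qed (use h(1) in \<open>auto simp: good_def\<close>)
qed

end

section \<open>Bisections of etale groupoids\<close>

context algebraic_groupoid
begin

lemma src_ginv: "src G (ginv G g) = rng G g"
  by (simp add: src_def rng_def ginv_ginv)

lemma rng_ginv: "rng G (ginv G g) = src G g"
  by (simp add: src_def rng_def ginv_ginv)

lemma rng_rng: "rng G (rng G g) = rng G g"
  using rng_gmul[of g "ginv G g"] by (simp add: composable_def rng_ginv) (simp add: rng_def)

lemma src_rng: "src G (rng G g) = rng G g"
  using src_gmul[of g "ginv G g"] by (simp add: composable_def rng_ginv src_ginv) (simp add: rng_def)

lemma rng_src: "rng G (src G g) = src G g"
  by (metis rng_rng rng_ginv)

lemma rng_in_gunits: "rng G g \<in> gunits G"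
  by (simp add: gunits_def)

lemma src_in_gunits: "src G g \<in> gunits G"
  by (metis rng_ginv rng_in_gunits)

lemma gunits_rng: "x \<in> gunits G \<Longrightarrow> rng G x = x"
  by (auto simp: gunits_def rng_rng)

lemma gunits_src: "x \<in> gunits G \<Longrightarrow> src G x = x"
  by (auto simp: gunits_def src_rng)

lemma gunits_ginv: "x \<in> gunits G \<Longrightarrow> ginv G x = x"
  by (metis gmul_rng gunits_rng gunits_src rng_def rng_ginv)

lemma gmul_unit_left: "rng G g = x \<Longrightarrow> gmul G x g = g"
  using gmul_rng by blast

lemma ginv_gmul_cancel:
  assumes "rng G h = rng G g"
  shows "gmul G h (gmul G (ginv G h) g) = g"
proof -
  have "gmul G (gmul G h (ginv G h)) g = gmul G h (gmul G (ginv G h) g)"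
    using assms by (intro gmul_assoc) (auto simp: composable_def rng_ginv src_ginv)
  then show ?thesis
    using assms gmul_rng[of g] by (simp add: rng_def)
qed

lemma rng_ginv_gmul:
  assumes "rng G h = rng G g"
  shows "rng G (gmul G (ginv G h) g) = src G h"
  using assms by (simp add: rng_gmul composable_def src_ginv rng_ginv)

end

lemma local_homeomorphism_onto_continuous:
  assumes "local_homeomorphism_onto f T"
  shows "continuous_on UNIV f"
proof -
  have "\<Union>{U. open U \<and> continuous_on U f} = UNIV"
    using assms unfolding local_homeomorphism_onto_def homeomorphism_def by blast
  moreover have "continuous_on (\<Union>{U. open U \<and> continuous_on U f}) f"
    by (rule continuous_on_open_Union) auto
  ultimately show ?thesis
    by simp
qed

lemma local_homeomorphism_onto_openin:
  assumes "local_homeomorphism_onto f T" "open W"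
  shows "openin (top_of_set T) (f ` W)"
proof (subst openin_subopen, clarify)
  fix x assume x: "x \<in> W"
  obtain U q where U: "open U" "x \<in> U" "openin (top_of_set T) (f ` U)" "homeomorphism U (f ` U) f q"
    using assms unfolding local_homeomorphism_onto_def by blast
  have "openin (top_of_set U) (U \<inter> W)"
    using assms(2) by (simp add: openin_open_Int)
  then have "openin (top_of_set (f ` U)) (f ` (U \<inter> W))"
    using U(4) homeomorphism_imp_open_map by blast
  then have "openin (top_of_set T) (f ` (U \<inter> W))"
    using U(3) openin_trans by blast
  then show "\<exists>S. openin (top_of_set T) S \<and> f x \<in> S \<and> S \<subseteq> f ` W"
    using U(2) x by (intro exI[of _ "f ` (U \<inter> W)"]) auto
qed

lemma local_homeomorphism_onto_locally_injective:
  assumes "local_homeomorphism_onto f T"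
  obtains U where "open U" "x \<in> U" "inj_on f U"
  using assms unfolding local_homeomorphism_onto_def homeomorphism_def
  by (metis inj_on_inverseI)

text \<open>Injectivity is enough here: source and range of an etale groupoid are continuous and
  open, so on \<open>U\<close> they are homeomorphisms onto open images.\<close>

definition bisection :: "('g::topological_space) groupoid_struct \<Rightarrow> 'g set \<Rightarrow> bool" where
  "bisection G U \<longleftrightarrow> open U \<and> inj_on (src G) U \<and> inj_on (rng G) U"

context locally_compact_etale_groupoid
begin

text \<open>Let \<open>rng G\<close> be injective on a neighbourhood \<open>U\<close> of a unit. If
  both \<open>g\<close> and \<open>rng G g\<close> lie in \<open>U\<close>, they have the same
  range, hence are equal, and \<open>g\<close> is a unit.\<close>

lemma open_gunits: "open (gunits G)"
proof (subst open_subopen, clarify)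
  fix x assume x: "x \<in> gunits G"
  obtain U where U: "open U" "x \<in> U" "inj_on (rng G) U"
    using local_homeomorphism_onto_locally_injective[OF rng_local_homeomorphism] .
  have "open (rng G -` U)"
    using local_homeomorphism_onto_continuous[OF rng_local_homeomorphism] U(1)
    by (simp add: continuous_on_open_vimage[OF open_UNIV])
  moreover have "U \<inter> rng G -` U \<subseteq> gunits G"
  proof
    fix g assume g: "g \<in> U \<inter> rng G -` U"
    then have "rng G g = g"
      using U(3) rng_rng by (auto dest: inj_onD)
    then show "g \<in> gunits G"
      by (metis rng_in_gunits)
  qed
  ultimately show "\<exists>T. open T \<and> x \<in> T \<and> T \<subseteq> gunits G"
    using U x gunits_rng by (intro exI[of _ "U \<inter> rng G -` U"]) auto
qed

text \<open>The open map \<open>rng G\<close> fixes units, so it carries a compact neighbourhood of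
  \<open>x\<close> in the groupoid to one in the unit space.\<close>

lemma locally_compact_gunits: "locally_compact_space (top_of_set (gunits G))"
  unfolding locally_compact_space_def
proof
  fix x assume "x \<in> topspace (top_of_set (gunits G))"
  then have x: "x \<in> gunits G"
    by simp
  obtain W K where W: "open W" "compact K" "x \<in> W" "W \<subseteq> K"
    using locally_compact unfolding locally_compact_space_def by (auto dest!: spec[of _ x])
  have "openin (top_of_set (gunits G)) (rng G ` W)"
    using local_homeomorphism_onto_openin[OF rng_local_homeomorphism W(1)] .
  moreover have "compact (rng G ` K)"
    using local_homeomorphism_onto_continuous[OF rng_local_homeomorphism] W(2)
      compact_continuous_image continuous_on_subset by blast
  then have "compactin (top_of_set (gunits G)) (rng G ` K)"
    using rng_in_gunits by (auto simp: compactin_subtopology)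
  moreover have "x \<in> rng G ` W"
    using gunits_rng[OF x] W(3) by force
  ultimately show "\<exists>U K. openin (top_of_set (gunits G)) U \<and> compactin (top_of_set (gunits G)) K \<and>
      x \<in> U \<and> U \<subseteq> K"
    using W(4) by (intro exI[of _ "rng G ` W"] exI[of _ "rng G ` K"]) auto
qed

lemma etale_map_gunits:
  assumes "local_homeomorphism_onto t (gunits G)"
  shows "etale_map t (gunits G)"
proof
  show "open (t ` W)" if "open W" for W
    using local_homeomorphism_onto_openin[OF assms that] open_gunits openin_open_trans by blast
  show "t g \<in> gunits G" for g
    using assms unfolding local_homeomorphism_onto_def by blast
qed (use open_gunits Hausdorff_units locally_compact_gunits
      local_homeomorphism_onto_continuous[OF assms] in auto)

sublocale src: etale_map "src G" "gunits G"
  by (rule etale_map_gunits[OF src_local_homeomorphism])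

sublocale rng: etale_map "rng G" "gunits G"
  by (rule etale_map_gunits[OF rng_local_homeomorphism])

lemma bisection_subset: "bisection G U \<Longrightarrow> open V \<Longrightarrow> V \<subseteq> U \<Longrightarrow> bisection G V"
  unfolding bisection_def by (meson inj_on_subset)

lemma bisection_Hausdorff: "bisection G U \<Longrightarrow> Hausdorff_space (top_of_set U)"
  unfolding bisection_def using src.slice_Hausdorff by blast

lemma bisection_gunits: "bisection G (gunits G)"
  unfolding bisection_def using open_gunits
  by (auto intro!: inj_onI simp: gunits_rng gunits_src)

lemma bisection_neighbourhood:
  obtains U where "bisection G U" "g \<in> U"
proof -
  obtain U where U: "open U" "g \<in> U" "inj_on (src G) U"
    using local_homeomorphism_onto_locally_injective[OF src_local_homeomorphism] .
  obtain V where V: "open V" "g \<in> V" "inj_on (rng G) V"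
    using local_homeomorphism_onto_locally_injective[OF rng_local_homeomorphism] .
  have "bisection G (U \<inter> V)"
    unfolding bisection_def using U V by (auto intro: inj_on_subset)
  then show thesis
    using that U V by blast
qed

lemma open_ginv_vimage: "open U \<Longrightarrow> open (ginv G -` U)"
  using continuous_ginv by (simp add: continuous_on_open_vimage[OF open_UNIV])

lemma bisection_ginv:
  assumes "bisection G U"
  shows "bisection G (ginv G -` U)"
  unfolding bisection_def
proof (intro conjI inj_onI)
  show "open (ginv G -` U)"
    using assms open_ginv_vimage unfolding bisection_def by blast
next
  fix g h assume "g \<in> ginv G -` U" "h \<in> ginv G -` U" "src G g = src G h"
  then have "ginv G g = ginv G h"
    using assms unfolding bisection_def by (metis rng_ginv inj_onD vimageD)
  then show "g = h"
    by (metis ginv_ginv)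
next
  fix g h assume "g \<in> ginv G -` U" "h \<in> ginv G -` U" "rng G g = rng G h"
  then have "ginv G g = ginv G h"
    using assms unfolding bisection_def by (metis src_ginv inj_onD vimageD)
  then show "g = h"
    by (metis ginv_ginv)
qed

end

section \<open>Coordinates of sections\<close>

context banach_line_bundle
begin

lemma proj_lzero: "proj L (lzero L g) = g"
  using monoid.one_closed[of "fibre_group L g"] fibre_comm_group[of g]
  by (auto simp: comm_group_def group_def fibre_group_def fibre_def)

lemma lscale_0: "lscale L 0 a = lzero L (proj L a)"
proof -
  interpret comm_group "fibre_group L (proj L a)"
    by (rule fibre_comm_group)
  have "lscale L 0 a \<in> carrier (fibre_group L (proj L a))"
    by (simp add: fibre_group_def fibre_def proj_lscale)
  moreover have "lscale L 0 a \<otimes>\<^bsub>fibre_group L (proj L a)\<^esub> lscale L 0 a = lscale L 0 a"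
    using lscale_add[of 0 0 a] by (simp add: fibre_group_def)
  ultimately show ?thesis
    using l_cancel_one by (simp add: fibre_group_def)
qed

lemma lnorm_lzero: "lnorm L (lzero L g) = 0"
  by (simp add: lnorm_eq_0 proj_lzero)

lemma ex_unit_vector: "\<exists>a. proj L a = g \<and> lnorm L a = 1"
proof -
  obtain a where a: "proj L a = g" "a \<noteq> lzero L g"
    using fibre_one_dim[of g] by (auto simp: fibre_def)
  then have "lnorm L a > 0"
    by (metis lnorm_eq_0 lnorm_nonneg less_eq_real_def)
  then show ?thesis
    using a by (intro exI[of _ "lscale L (1 / lnorm L a) a"])
      (auto simp: proj_lscale lnorm_lscale norm_divide)
qed

lemma lscale_cancel:
  assumes "lnorm L a \<noteq> 0" "lscale L c a = lscale L d a"
  shows "c = d"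
proof -
  have "lscale L (c - d) a = lscale L 0 a"
    using assms(2) lscale_add[of c "- d" a] lscale_add[of d "- d" a] by simp
  then have "cmod (c - d) * lnorm L a = 0"
    by (metis lnorm_lscale norm_zero mult_zero_left)
  then show ?thesis
    using assms(1) by simp
qed

end

text \<open>
  A choice of unit vectors identifies every fibre with the complex numbers isometrically. The
  choice need not be continuous, so continuity is always that of the section and never
  that of its coordinate function.
\<close>

locale framed_line_bundle = banach_line_bundle L
  for L :: "('g::topological_space, 'l::topological_space, 'z) line_bundle_struct_scheme" +
  fixes u :: "'g \<Rightarrow> 'l"
  assumes proj_u: "proj L (u g) = g"
    and lnorm_u: "lnorm L (u g) = 1"
begin

definition sec :: "('g \<Rightarrow> complex) \<Rightarrow> 'g \<Rightarrow> 'l" where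
  "sec F = (\<lambda>g. lscale L (F g) (u g))"

definition coordinates :: "'g set \<Rightarrow> ('g \<Rightarrow> complex) set" where
  "coordinates U = {F. continuous_on U (sec F) \<and>
     (\<exists>K. compact K \<and> K \<subseteq> U \<and> (\<forall>g. g \<notin> K \<longrightarrow> F g = 0))}"

lemma proj_sec: "proj L (sec F g) = g"
  by (simp add: sec_def proj_lscale proj_u)

lemma lnorm_sec: "lnorm L (sec F g) = cmod (F g)"
  by (simp add: sec_def lnorm_lscale lnorm_u)

lemma sec_eq_lzero_iff: "sec F g = lzero L g \<longleftrightarrow> F g = 0"
  using lnorm_eq_0[of "sec F g"] by (simp add: proj_sec lnorm_sec)

lemma section_add_sec: "section_add L (sec F) (sec F') = sec (\<lambda>g. F g + F' g)"
  by (simp add: section_add_def sec_def lscale_add)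

lemma section_scale_sec: "section_scale L c (sec F) = sec (\<lambda>g. c * F g)"
  by (simp add: section_scale_def sec_def lscale_lscale)

lemma fibre_coordinate: "\<exists>c. a = lscale L c (u (proj L a))"
proof -
  obtain b where b: "fibre L (proj L a) = range (\<lambda>c. lscale L c b)"
    using fibre_one_dim[of "proj L a"] by blast
  obtain c d where c: "a = lscale L c b" and d: "u (proj L a) = lscale L d b"
    using b proj_u[of "proj L a"] by (fastforce simp: fibre_def set_eq_iff image_iff)
  have "d \<noteq> 0"
    using d lnorm_u[of "proj L a"] lnorm_lscale[of d b] by auto
  then have "lscale L (c / d) (u (proj L a)) = a"
    unfolding d by (simp add: lscale_lscale c)
  then show ?thesis
    by metis
qed

lemma ex_sec:
  assumes "\<And>g. \<eta> g \<in> fibre L g"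
  obtains F where "\<eta> = sec F"
proof -
  have "\<exists>c. \<eta> g = lscale L c (u g)" for g
    using fibre_coordinate[of "\<eta> g"] assms[of g] by (simp add: fibre_def)
  then obtain F where "\<And>g. \<eta> g = lscale L (F g) (u g)"
    by metis
  then show thesis
    using that[of F] by (auto simp: sec_def)
qed

lemma continuous_on_sec_norm: "continuous_on U (sec F) \<Longrightarrow> continuous_on U (\<lambda>g. cmod (F g))"
  using continuous_on_compose2[OF continuous_lnorm, of U "sec F"] by (simp add: lnorm_sec)

text \<open>The axiom on nets of small norm, applied to the image of the neighbourhood filter under
  \<open>sec F\<close>. At zeros of a section, control of the norm therefore suffices.\<close>

lemma tendsto_zero_section:
  assumes "((\<lambda>g. cmod (F g)) \<longlongrightarrow> 0) (at g0 within U)" "F g0 = 0"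
  shows "(sec F \<longlongrightarrow> sec F g0) (at g0 within U)"
proof -
  have "((\<lambda>a. a) \<longlongrightarrow> lzero L g0) (filtermap (sec F) (at g0 within U))"
  proof (rule small_norm_limit)
    show "(lnorm L \<longlongrightarrow> 0) (filtermap (sec F) (at g0 within U))"
      using assms(1) by (simp add: filterlim_filtermap lnorm_sec)
    show "(proj L \<longlongrightarrow> g0) (filtermap (sec F) (at g0 within U))"
      by (simp add: filterlim_filtermap proj_sec)
  qed
  then show ?thesis
    using assms(2) sec_eq_lzero_iff[of F g0] by (simp add: filterlim_filtermap)
qed

lemma continuous_on_sec_add:
  assumes "continuous_on U (sec F)" "continuous_on U (sec F')"
  shows "continuous_on U (sec (\<lambda>g. F g + F' g))"
proof -
  have "continuous_on U (\<lambda>g. (\<lambda>(a, b). ladd L a b) (sec F g, sec F' g))"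
    by (rule continuous_on_compose2[OF continuous_ladd])
       (auto intro!: continuous_on_Pair assms simp: proj_sec)
  then show ?thesis
    by (simp add: section_add_sec[symmetric] section_add_def)
qed

lemma continuous_on_sec_mult:
  assumes "continuous_on U (sec F)" "continuous_on U k"
  shows "continuous_on U (sec (\<lambda>g. k g * F g))"
proof -
  have "continuous_on U (\<lambda>g. (\<lambda>(c, a). lscale L c a) (k g, sec F g))"
    by (rule continuous_on_compose2[OF continuous_lscale])
       (auto intro!: continuous_on_Pair assms)
  then show ?thesis
    by (simp add: sec_def lscale_lscale)
qed

lemma continuous_on_sec_zero: "continuous_on U (sec (\<lambda>g. 0))"
  unfolding continuous_on_def by (intro ballI tendsto_zero_section) auto

lemma continuous_on_sec_sum:
  "(\<And>i. i \<in> I \<Longrightarrow> continuous_on U (sec (F i))) \<Longrightarrow> continuous_on U (sec (\<lambda>g. \<Sum>i\<in>I. F i g))"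
  by (induction I rule: infinite_finite_induct)
     (auto intro: continuous_on_sec_zero continuous_on_sec_add)

text \<open>Meant for coefficients that blow up at the zeros of \<open>F\<close>. Where
  \<open>F\<close> is nonzero, multiplication is continuous; at a zero the norm of the product tends
  to zero.\<close>

lemma continuous_on_sec_mult_nonzero:
  assumes U: "open U" and F: "continuous_on U (sec F)" and k: "continuous_on {g \<in> U. F g \<noteq> 0} k"
    and kF: "continuous_on U (\<lambda>g. cmod (k g * F g))"
  shows "continuous_on U (sec (\<lambda>g. k g * F g))"
  unfolding continuous_on_def
proof
  fix g0 assume g0: "g0 \<in> U"
  show "(sec (\<lambda>g. k g * F g) \<longlongrightarrow> sec (\<lambda>g. k g * F g) g0) (at g0 within U)"
  proof (cases "F g0 = 0")
    case True
    then show ?thesis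
      using kF g0 unfolding continuous_on_def by (intro tendsto_zero_section) force+
  next
    case False
    let ?N = "{g \<in> U. F g \<noteq> 0}"
    have "?N = U \<inter> (\<lambda>g. cmod (F g)) -` {0<..}"
      by auto
    then have N: "open ?N"
      using continuous_open_preimage[OF continuous_on_sec_norm[OF F] U, of "{0<..}"] by simp
    have "continuous_on ?N (sec (\<lambda>g. k g * F g))"
      by (intro continuous_on_sec_mult k continuous_on_subset[OF F]) auto
    then show ?thesis
      using g0 False at_within_open[OF _ N, of g0] at_within_open[OF g0 U]
      unfolding continuous_on_def by auto
  qed
qed

lemma coordinatesI:
  assumes "continuous_on U (sec F)" "compact K" "K \<subseteq> U" "\<And>g. g \<notin> K \<Longrightarrow> F g = 0"
  shows "F \<in> coordinates U"
  using assms unfolding coordinates_def by blast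

lemma coordinates_continuous: "F \<in> coordinates U \<Longrightarrow> continuous_on U (sec F)"
  by (simp add: coordinates_def)

lemma coordinates_outside: "F \<in> coordinates U \<Longrightarrow> g \<notin> U \<Longrightarrow> F g = 0"
  unfolding coordinates_def by blast

lemma coordinates_norm_Cc:
  assumes "F \<in> coordinates U"
  shows "(\<lambda>g. cmod (F g)) \<in> Cc U"
  using assms unfolding coordinates_def Cc_def by (force intro: continuous_on_sec_norm)

lemma coordinates_zero: "(\<lambda>g. 0) \<in> coordinates U"
  by (rule coordinatesI[of _ _ "{}"]) (auto intro: continuous_on_sec_zero)

lemma coordinates_add:
  assumes "F \<in> coordinates U" "F' \<in> coordinates U"
  shows "(\<lambda>g. F g + F' g) \<in> coordinates U"
proof -
  obtain K where K: "compact K" "K \<subseteq> U" "\<And>g. g \<notin> K \<Longrightarrow> F g = 0"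
    using assms(1) unfolding coordinates_def by blast
  obtain K' where K': "compact K'" "K' \<subseteq> U" "\<And>g. g \<notin> K' \<Longrightarrow> F' g = 0"
    using assms(2) unfolding coordinates_def by blast
  have "continuous_on U (sec (\<lambda>g. F g + F' g))"
    by (intro continuous_on_sec_add assms[THEN coordinates_continuous])
  then show ?thesis
    by (rule coordinatesI[of _ _ "K \<union> K'"]) (use K K' in auto)
qed

lemma coordinates_mult:
  assumes "F \<in> coordinates U" "continuous_on U k"
  shows "(\<lambda>g. k g * F g) \<in> coordinates U"
proof -
  obtain K where K: "continuous_on U (sec F)" "compact K" "K \<subseteq> U" "\<And>g. g \<notin> K \<Longrightarrow> F g = 0"
    using assms(1) unfolding coordinates_def by blast
  then show ?thesis
    by (intro coordinatesI[of _ _ K] continuous_on_sec_mult assms(2)) auto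
qed

lemma coordinates_Cc_mult:
  assumes "h \<in> Cc U" "continuous_on U (sec F)"
  shows "(\<lambda>g. complex_of_real (h g) * F g) \<in> coordinates U"
proof -
  obtain K where K: "compact K" "K \<subseteq> U" "\<And>x. x \<notin> K \<Longrightarrow> h x = 0"
    using assms(1) unfolding Cc_def by blast
  show ?thesis
    by (rule coordinatesI[OF _ K(1,2)])
       (auto intro!: continuous_on_sec_mult assms(2) continuous_on_of_real Cc_continuous assms(1)
         simp: K(3))
qed

lemma coordinates_mono:
  assumes "F \<in> coordinates V" "open V" "V \<subseteq> U" "open U" "Hausdorff_space (top_of_set U)"
  shows "F \<in> coordinates U"
proof -
  obtain K where K: "continuous_on V (sec F)" "compact K" "K \<subseteq> V" "\<And>x. x \<notin> K \<Longrightarrow> F x = 0"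
    using assms(1) unfolding coordinates_def by blast
  have op: "open (U - K)"
    using assms K open_Diff_compact by blast
  have "continuous_on (U - K) (sec F)"
    by (rule continuous_on_eq[OF continuous_on_sec_zero]) (auto simp: K(4) sec_def)
  then have "continuous_on (V \<union> (U - K)) (sec F)"
    by (intro continuous_on_open_Un op assms(2) K(1))
  moreover have "V \<union> (U - K) = U"
    using K assms by blast
  ultimately show ?thesis
    using K assms by (intro coordinatesI[of _ _ K]) auto
qed

text \<open>The quotient has norm \<open>sqrt (cmod (F g))\<close>, which is continuous and vanishes
  at the zeros of \<open>F\<close> although the coefficient is unbounded near them.\<close>

lemma coordinates_divide_sqrt_norm:
  assumes "open U" "F \<in> coordinates U"
  shows "(\<lambda>g. complex_of_real (1 / sqrt (cmod (F g))) * F g) \<in> coordinates U"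
proof -
  obtain K where K: "continuous_on U (sec F)" "compact K" "K \<subseteq> U" "\<And>g. g \<notin> K \<Longrightarrow> F g = 0"
    using assms(2) unfolding coordinates_def by blast
  have n: "continuous_on U (\<lambda>g. cmod (F g))"
    by (rule continuous_on_sec_norm[OF K(1)])
  have "continuous_on U (sec (\<lambda>g. complex_of_real (1 / sqrt (cmod (F g))) * F g))"
  proof (rule continuous_on_sec_mult_nonzero[OF assms(1) K(1)])
    show "continuous_on {g \<in> U. F g \<noteq> 0} (\<lambda>g. complex_of_real (1 / sqrt (cmod (F g))))"
      by (intro continuous_on_of_real continuous_on_divide continuous_on_const
          continuous_on_real_sqrt continuous_on_subset[OF n]) auto
    have "cmod (complex_of_real (1 / sqrt (cmod (F g))) * F g) = sqrt (cmod (F g))" for g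
      by (simp add: norm_mult norm_divide real_div_sqrt)
    then show "continuous_on U (\<lambda>g. cmod (complex_of_real (1 / sqrt (cmod (F g))) * F g))"
      using continuous_on_real_sqrt[OF n] by simp
  qed
  then show ?thesis
    by (rule coordinatesI[OF _ K(2,3)]) (simp add: K(4))
qed

lemma sec_in_Gamma_c_on:
  assumes "Hausdorff_space (top_of_set U)" "F \<in> coordinates U"
  shows "sec F \<in> Gamma_c_on L U"
proof -
  obtain K where K: "continuous_on U (sec F)" "compact K" "K \<subseteq> U" "\<And>g. g \<notin> K \<Longrightarrow> F g = 0"
    using assms(2) unfolding coordinates_def by blast
  let ?S = "{g \<in> U. sec F g \<noteq> lzero L g}"
  have cK: "compactin (top_of_set U) K"
    using K by (simp add: compactin_subtopology)
  then have "closedin (top_of_set U) K"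
    using compactin_imp_closedin assms(1) by blast
  moreover have "?S \<subseteq> K"
    using K(4) by (auto simp: sec_eq_lzero_iff)
  ultimately have "top_of_set U closure_of ?S \<subseteq> K"
    by (rule closure_of_minimal[rotated])
  then have "compactin (top_of_set U) (top_of_set U closure_of ?S)"
    using closed_compactin cK closedin_closure_of by blast
  then show ?thesis
    using K by (auto simp: Gamma_c_on_def fibre_def proj_sec compactin_subtopology sec_eq_lzero_iff)
qed

lemma sec_in_Gamma_c:
  "open U \<Longrightarrow> Hausdorff_space (top_of_set U) \<Longrightarrow> F \<in> coordinates U \<Longrightarrow> sec F \<in> Gamma_c L"
  using Gamma_c.base sec_in_Gamma_c_on by blast

lemma Gamma_c_on_sec:
  assumes "\<eta> \<in> Gamma_c_on L U"
  obtains F where "F \<in> coordinates U" "\<eta> = sec F"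
proof -
  obtain F where F: "\<eta> = sec F"
    using assms ex_sec[of \<eta>] unfolding Gamma_c_on_def by blast
  let ?K = "top_of_set U closure_of {g \<in> U. \<eta> g \<noteq> lzero L g}"
  have "F \<in> coordinates U"
  proof (rule coordinatesI)
    show "continuous_on U (sec F)" "compact ?K"
      using assms F by (auto simp: Gamma_c_on_def)
    show "?K \<subseteq> U"
      using closure_of_subset_topspace by (metis topspace_euclidean_subtopology)
    fix g assume g: "g \<notin> ?K"
    have "{g \<in> U. \<eta> g \<noteq> lzero L g} \<subseteq> ?K"
      by (rule closure_of_subset) auto
    then have "\<eta> g = lzero L g"
      using g assms by (auto simp: Gamma_c_on_def)
    then show "F g = 0"
      by (simp add: F sec_eq_lzero_iff)
  qed
  then show thesis
    using that F by blast
qed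

end

section \<open>Fell line bundles\<close>

text \<open>\<open>\<phi> e\<close> is an idempotent complex number, nonzero by injectivity. The
  positivity axiom only asserts that some \<phi> exists, and this normalisation lets coefficients be
  read off from whichever one it supplies.\<close>

lemma unit_fibre_iso_idempotent:
  assumes \<phi>: "unit_fibre_iso L x \<phi>" and L: "banach_line_bundle L"
    and e: "proj L e = x" "lmul L e e = e" "e \<noteq> lzero L x"
  shows "\<phi> e = 1"
proof -
  interpret banach_line_bundle L
    by (rule L)
  have e_in: "e \<in> fibre L x"
    using e by (simp add: fibre_def)
  then have "\<phi> e * \<phi> e = \<phi> e"
    using \<phi> e(2) unfolding unit_fibre_iso_def by metis
  moreover have "\<phi> e \<noteq> 0"
  proof
    assume "\<phi> e = 0"
    have "lscale L 0 e = lzero L x"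
      using e by (simp add: lscale_0)
    then have "\<phi> (lzero L x) = 0"
      using \<phi> e_in unfolding unit_fibre_iso_def by (metis mult_zero_left)
    with \<open>\<phi> e = 0\<close> have "e = lzero L x"
      using \<phi> e_in proj_lzero[of x] unfolding unit_fibre_iso_def
      by (metis (mono_tags, lifting) bij_betw_def fibre_def inj_onD mem_Collect_eq)
    then show False
      using e by simp
  qed
  ultimately show ?thesis
    by simp
qed

context fell_line_bundle
begin

lemma unit_composable: "x \<in> gunits G \<Longrightarrow> composable G x x"
  by (simp add: composable_def gunits_rng gunits_src)

lemma unit_gmul: "x \<in> gunits G \<Longrightarrow> gmul G x x = x"
  by (metis gmul_unit_left gunits_rng)

text \<open>The identification comes out of the positivity axiom, applied to the zero vector over
  \<open>x\<close>.\<close>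

lemma ex_unit_fibre_iso:
  assumes "x \<in> gunits G"
  obtains \<phi> where "unit_fibre_iso L x \<phi>"
  using lstar_lmul_self_nonneg[of "lzero L x"] gunits_src[OF assms] by (auto simp: proj_lzero)

lemma ex_idempotent:
  assumes x: "x \<in> gunits G"
  obtains e where "proj L e = x" "lmul L e e = e" "e \<noteq> lzero L x" "lstar L e = e" "lnorm L e = 1"
proof -
  obtain \<phi> where \<phi>: "unit_fibre_iso L x \<phi>"
    using ex_unit_fibre_iso[OF x] .
  then have bij: "bij_betw \<phi> (fibre L x) UNIV"
    by (simp add: unit_fibre_iso_def)
  then obtain e where e: "e \<in> fibre L x" "\<phi> e = 1"
    unfolding bij_betw_def by (metis UNIV_I imageE)
  have eqI: "a = b" if "a \<in> fibre L x" "b \<in> fibre L x" "\<phi> a = \<phi> b" for a b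
    using bij that by (auto simp: bij_betw_def dest: inj_onD)
  have pe: "proj L e = x"
    using e by (simp add: fibre_def)
  have "lmul L e e \<in> fibre L x"
    using x pe by (simp add: fibre_def proj_lmul unit_composable unit_gmul)
  moreover have "\<phi> (lmul L e e) = 1"
    using \<phi> e unfolding unit_fibre_iso_def by (metis mult_1)
  ultimately have ee: "lmul L e e = e"
    using e by (intro eqI) auto
  have "lscale L 0 e = lzero L x"
    using pe by (simp add: lscale_0)
  then have "\<phi> (lzero L x) = 0"
    using \<phi> e unfolding unit_fibre_iso_def by (metis mult_zero_left)
  then have nz: "e \<noteq> lzero L x"
    using e by auto
  have "lstar L e \<in> fibre L x"
    using x pe by (simp add: fibre_def proj_lstar gunits_ginv)
  moreover have "\<phi> (lstar L e) = 1"
    using \<phi> e unfolding unit_fibre_iso_def by (metis complex_cnj_one)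
  ultimately have star: "lstar L e = e"
    using e by (intro eqI) auto
  have "lnorm L e = lnorm L e * lnorm L e"
    using lnorm_lmul[of e e] ee pe x by (simp add: unit_composable)
  moreover have "lnorm L e \<noteq> 0"
    using nz pe lnorm_eq_0 by auto
  ultimately have "lnorm L e = 1"
    by simp
  then show thesis
    using that pe ee nz star by blast
qed

text \<open>Over units the self-adjoint idempotent makes the coordinates canonical and compatible
  with product and star; elsewhere any unit vector will do.\<close>

definition unit_vector :: "'g \<Rightarrow> 'l" where
  "unit_vector g = (SOME a. proj L a = g \<and> lnorm L a = 1 \<and>
     (g \<in> gunits G \<longrightarrow> lmul L a a = a \<and> lstar L a = a))"

lemma unit_vector:
  "proj L (unit_vector g) = g" "lnorm L (unit_vector g) = 1"
  "g \<in> gunits G \<Longrightarrow> lmul L (unit_vector g) (unit_vector g) = unit_vector g"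
  "g \<in> gunits G \<Longrightarrow> lstar L (unit_vector g) = unit_vector g"
proof -
  have "\<exists>a. proj L a = g \<and> lnorm L a = 1 \<and> (g \<in> gunits G \<longrightarrow> lmul L a a = a \<and> lstar L a = a)"
  proof (cases "g \<in> gunits G")
    case True
    then show ?thesis
      using ex_idempotent by metis
  next
    case False
    then show ?thesis
      using ex_unit_vector by blast
  qed
  from someI_ex[OF this, folded unit_vector_def]
  show "proj L (unit_vector g) = g" "lnorm L (unit_vector g) = 1"
    "g \<in> gunits G \<Longrightarrow> lmul L (unit_vector g) (unit_vector g) = unit_vector g"
    "g \<in> gunits G \<Longrightarrow> lstar L (unit_vector g) = unit_vector g"
    by blast+
qed

sublocale framed_line_bundle L unit_vector
  by unfold_locales (rule unit_vector)+

lemma unit_vector_nonzero: "unit_vector g \<noteq> lzero L g"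
  using unit_vector(2)[of g] lnorm_lzero[of g] by auto

text \<open>On the one-dimensional fibre of \<open>a\<close>, multiplication by the idempotent is a
  scalar \<open>q\<close> with \<open>q * q = q\<close>, and multiplicativity of the norm excludes
  \<open>q = 0\<close>.\<close>

lemma lmul_unit_vector_left:
  assumes "rng G (proj L a) = x"
  shows "lmul L (unit_vector x) a = a"
proof (cases "lnorm L a = 0")
  case True
  have x: "x \<in> gunits G"
    using assms rng_in_gunits by blast
  have c: "composable G (proj L (unit_vector x)) (proj L a)"
    using assms x by (simp add: composable_def unit_vector gunits_src)
  have "lscale L 0 a = a"
    using True by (simp add: lscale_0 lnorm_eq_0)
  then have "lmul L (unit_vector x) a = lscale L 0 (lmul L (unit_vector x) a)"
    by (metis lmul_lscale_right[OF c])
  also have "\<dots> = lzero L (proj L a)"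
    using assms by (simp add: lscale_0 proj_lmul[OF c] unit_vector gmul_unit_left)
  also have "\<dots> = a"
    using True by (simp add: lnorm_eq_0)
  finally show ?thesis .
next
  case False
  let ?e = "unit_vector x"
  have x: "x \<in> gunits G"
    using assms rng_in_gunits by blast
  have c: "composable G (proj L ?e) (proj L a)"
    using assms x by (simp add: composable_def unit_vector gunits_src)
  have cc: "composable G (proj L ?e) (proj L ?e)"
    using x by (simp add: unit_vector unit_composable)
  have p: "proj L (lmul L ?e a) = proj L a"
    using assms by (simp add: proj_lmul[OF c] unit_vector gmul_unit_left)
  obtain k where k: "lmul L ?e a = lscale L k (unit_vector (proj L a))"
    using fibre_coordinate[of "lmul L ?e a"] p by auto
  obtain l where l: "a = lscale L l (unit_vector (proj L a))"
    using fibre_coordinate by blast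
  have l0: "l \<noteq> 0"
    using False l lnorm_lscale[of l "unit_vector (proj L a)"] by auto
  define q where "q = k / l"
  have "lscale L q a = lscale L q (lscale L l (unit_vector (proj L a)))"
    using l by simp
  then have q: "lmul L ?e a = lscale L q a"
    using k l0 by (simp add: q_def lscale_lscale)
  have "lmul L ?e (lmul L ?e a) = lmul L ?e a"
    using lmul_assoc[OF cc c] unit_vector(3)[OF x] by simp
  moreover have "lmul L ?e (lmul L ?e a) = lscale L (q * q) a"
    by (simp add: q lmul_lscale_right[OF c] lscale_lscale)
  ultimately have "q * q = q"
    using q False lscale_cancel by metis
  moreover have "q \<noteq> 0"
    using lnorm_lmul[OF c] q False lnorm_lscale[of q a] unit_vector(2) by auto
  ultimately show ?thesis
    using q lscale_one by simp
qed

text \<open>Positivity of the bundle enters here: it makes the coefficient relative to the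
  idempotent real and nonnegative, and the norm then determines it.\<close>

lemma lstar_lmul_self:
  "lmul L (lstar L a) a = lscale L (complex_of_real ((lnorm L a)\<^sup>2)) (unit_vector (src G (proj L a)))"
proof -
  let ?x = "src G (proj L a)"
  have c: "composable G (proj L (lstar L a)) (proj L a)"
    by (simp add: composable_def proj_lstar src_ginv)
  have p: "proj L (lmul L (lstar L a) a) = ?x"
    by (simp add: proj_lmul[OF c] proj_lstar src_def)
  obtain \<phi> where \<phi>: "unit_fibre_iso L ?x \<phi>" "\<phi> (lmul L (lstar L a) a) \<in> \<real>\<^sub>\<ge>\<^sub>0"
    using lstar_lmul_self_nonneg[of a] by blast
  obtain k where k: "lmul L (lstar L a) a = lscale L k (unit_vector ?x)"
    using fibre_coordinate[of "lmul L (lstar L a) a"] p by auto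
  have "\<phi> (unit_vector ?x) = 1"
    using \<phi>(1) banach_line_bundle_axioms
    by (rule unit_fibre_iso_idempotent) (auto simp: unit_vector src_in_gunits unit_vector_nonzero)
  then have "\<phi> (lmul L (lstar L a) a) = k"
    using \<phi>(1) unfolding k unit_fibre_iso_def by (simp add: fibre_def unit_vector)
  then obtain r where r: "k = complex_of_real r" "0 \<le> r"
    using \<phi>(2) by (auto elim: nonneg_Reals_cases)
  have "lnorm L (lmul L (lstar L a) a) = (lnorm L a)\<^sup>2"
    using lnorm_lmul[OF c] by (simp add: lnorm_lstar power2_eq_square)
  then have "r = (lnorm L a)\<^sup>2"
    using r by (simp add: k lnorm_lscale unit_vector)
  then show ?thesis
    using k r by simp
qed

text \<open>
  Near a unit vector \<open>e\<^sub>x\<close> the map \<open>a \<mapsto> a\<^sup>*a / \<parallel>a\<parallel>\<^sup>2\<close> is continuous, and it sends \<open>a\<close> to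
  \<open>e\<^bsub>s(p(a))\<^esub>\<close>; since \<open>p\<close> is open, \<open>x \<mapsto> e\<^sub>x\<close> is continuous on units.
\<close>

lemma continuous_on_unit_vector: "continuous_on (gunits G) unit_vector"
  unfolding continuous_on_topological
proof (intro ballI allI impI)
  fix x W assume x: "x \<in> gunits G" and W: "open W" "unit_vector x \<in> W"
  let ?N = "{a. lnorm L a \<noteq> 0}"
  let ?Q = "\<lambda>a. lscale L (complex_of_real (1 / (lnorm L a)\<^sup>2)) (lmul L (lstar L a) a)"
  have Q: "?Q a = unit_vector (src G (proj L a))" if "lnorm L a \<noteq> 0" for a
    unfolding lstar_lmul_self using that by (simp add: lscale_lscale lscale_one)
  have N: "open ?N"
  proof -
    have "?N = lnorm L -` (- {0})"
      by auto
    then show ?thesis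
      using continuous_lnorm by (simp add: continuous_on_open_vimage[OF open_UNIV] open_Compl)
  qed
  have "continuous_on ?N (\<lambda>a. (\<lambda>(a, b). lmul L a b) (lstar L a, a))"
    by (rule continuous_on_compose2[OF continuous_lmul])
       (auto intro!: continuous_on_Pair continuous_on_id continuous_on_subset[OF continuous_lstar]
         simp: composable_def proj_lstar src_ginv)
  then have m: "continuous_on ?N (\<lambda>a. lmul L (lstar L a) a)"
    by simp
  have n: "continuous_on ?N (\<lambda>a. complex_of_real (1 / (lnorm L a)\<^sup>2))"
    by (intro continuous_on_of_real continuous_on_divide continuous_on_const continuous_on_power
        continuous_on_subset[OF continuous_lnorm]) auto
  have "continuous_on ?N (\<lambda>a. (\<lambda>(c, a). lscale L c a)
      (complex_of_real (1 / (lnorm L a)\<^sup>2), lmul L (lstar L a) a))"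
    by (rule continuous_on_compose2[OF continuous_lscale]) (intro continuous_on_Pair m n, simp)
  then have "continuous_on ?N ?Q"
    by simp
  then have "open (?N \<inter> ?Q -` W)"
    using N W(1) by (rule continuous_open_preimage)
  then have "open (proj L ` (?N \<inter> ?Q -` W))"
    by (rule proj_open)
  moreover have "x \<in> proj L ` (?N \<inter> ?Q -` W)"
    using W(2) x Q[of "unit_vector x"]
    by (intro image_eqI[of _ _ "unit_vector x"]) (auto simp: unit_vector gunits_src)
  moreover have "unit_vector y \<in> W" if "y \<in> gunits G" "y \<in> proj L ` (?N \<inter> ?Q -` W)" for y
    using that Q gunits_src[OF that(1)] by auto
  ultimately show "\<exists>A. open A \<and> x \<in> A \<and> (\<forall>y\<in>gunits G. y \<in> A \<longrightarrow> unit_vector y \<in> W)"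
    by blast
qed

lemma Cc_coordinates:
  assumes "a \<in> Cc (gunits G)"
  shows "(\<lambda>x. complex_of_real (a x)) \<in> coordinates (gunits G)"
proof -
  have "continuous_on (gunits G) (sec (\<lambda>_. 1))"
    using continuous_on_unit_vector by (simp add: sec_def lscale_one)
  from coordinates_Cc_mult[OF assms this] show ?thesis
    by simp
qed

section \<open>Functions on the unit space and convolution\<close>

definition unit_section :: "('g \<Rightarrow> real) \<Rightarrow> 'g \<Rightarrow> 'l" where
  "unit_section a = sec (\<lambda>x. complex_of_real (a x))"

lemma unit_section_in_Gamma_c: "a \<in> Cc (gunits G) \<Longrightarrow> unit_section a \<in> Gamma_c L"
  unfolding unit_section_def using sec_in_Gamma_c open_gunits Hausdorff_units Cc_coordinates by blast

lemma lmul_eq_lzero: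
  assumes "composable G (proj L a) (proj L b)" "lnorm L a = 0 \<or> lnorm L b = 0"
  shows "lmul L a b = lzero L (gmul G (proj L a) (proj L b))"
  using lnorm_eq_0[of "lmul L a b"] lnorm_lmul[OF assms(1)] assms(2) proj_lmul[OF assms(1)] by auto

text \<open>The convolutions computed below have at most one nonzero term, so the product in the
  fibre group collapses to it.\<close>

lemma convolution_eq_term:
  assumes t: "\<And>h. t h = lmul L (\<eta>1 h) (\<eta>2 (gmul G (ginv G h) g))"
    and h0: "rng G h0 = rng G g" and p: "proj L (t h0) = g"
    and zero: "\<And>h. rng G h = rng G g \<Longrightarrow> h \<noteq> h0 \<Longrightarrow> t h = lzero L g"
  shows "convolution G L \<eta>1 \<eta>2 g = t h0"
proof -
  interpret comm_group "fibre_group L g"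
    by (rule fibre_comm_group)
  have t_eq: "t = (\<lambda>h. lmul L (\<eta>1 h) (\<eta>2 (gmul G (ginv G h) g)))"
    using t by auto
  have c: "convolution G L \<eta>1 \<eta>2 g = finprod (fibre_group L g) t {h. rng G h = rng G g \<and> t h \<noteq> lzero L g}"
    unfolding convolution_def Let_def t_eq ..
  show ?thesis
  proof (cases "t h0 = lzero L g")
    case True
    then have e: "{h. rng G h = rng G g \<and> t h \<noteq> lzero L g} = {}"
      using zero by blast
    show ?thesis
      unfolding c e finprod_empty True by (simp add: fibre_group_def)
  next
    case False
    then have "{h. rng G h = rng G g \<and> t h \<noteq> lzero L g} = {h0}"
      using zero h0 by blast
    moreover have "t h0 \<in> carrier (fibre_group L g)"
      using p by (simp add: fibre_group_def fibre_def)
    ultimately show ?thesis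
      using c by (simp add: finprod_insert)
  qed
qed

lemma convolution_eq_lzero:
  assumes "\<And>h. rng G h = rng G g \<Longrightarrow> lmul L (\<eta>1 h) (\<eta>2 (gmul G (ginv G h) g)) = lzero L g"
  shows "convolution G L \<eta>1 \<eta>2 g = lzero L g"
proof -
  interpret comm_group "fibre_group L g"
    by (rule fibre_comm_group)
  have e: "{h. rng G h = rng G g \<and> lmul L (\<eta>1 h) (\<eta>2 (gmul G (ginv G h) g)) \<noteq> lzero L g} = {}"
    using assms by blast
  show ?thesis
    unfolding convolution_def Let_def e finprod_empty by (simp add: fibre_group_def)
qed

text \<open>\<open>unit_section a\<close> vanishes off the units, so only \<open>h = rng G g\<close>
  contributes, and there the idempotent acts as the identity.\<close>

lemma convolution_unit_section:
  assumes a: "a \<in> Cc (gunits G)"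
  shows "convolution G L (unit_section a) (sec F) = sec (\<lambda>g. complex_of_real (a (rng G g)) * F g)"
proof
  fix g
  let ?t = "\<lambda>h. lmul L (unit_section a h) (sec F (gmul G (ginv G h) g))"
  have comp: "composable G (proj L (unit_section a h)) (proj L (sec F (gmul G (ginv G h) g)))"
    if "rng G h = rng G g" for h
    using that by (simp add: composable_def proj_sec unit_section_def rng_ginv_gmul)
  have r: "gmul G (ginv G (rng G g)) g = g"
    by (simp add: gunits_ginv rng_in_gunits gmul_rng)
  have val: "?t (rng G g) = sec (\<lambda>g. complex_of_real (a (rng G g)) * F g) g"
  proof -
    have c: "composable G (proj L (unit_vector (rng G g))) (proj L (unit_vector g))"
      by (simp add: composable_def unit_vector src_rng)
    have c': "composable G (proj L (unit_vector (rng G g))) (proj L (lscale L (F g) (unit_vector g)))"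
      using c by (simp add: proj_lscale)
    show ?thesis
      unfolding r by (simp add: sec_def unit_section_def lmul_lscale_left[OF c'] lmul_lscale_right[OF c]
          lmul_unit_vector_left unit_vector lscale_lscale)
  qed
  have "convolution G L (unit_section a) (sec F) g = ?t (rng G g)"
  proof (rule convolution_eq_term[where t = ?t])
    show "proj L (?t (rng G g)) = g"
      using val by (simp add: proj_sec)
    fix h assume h: "rng G h = rng G g" "h \<noteq> rng G g"
    then have "h \<notin> gunits G"
      using gunits_rng by metis
    then have "lnorm L (unit_section a h) = 0"
      using Cc_outside[OF a] by (simp add: unit_section_def lnorm_sec)
    then show "?t h = lzero L g"
      using lmul_eq_lzero[OF comp[OF h(1)]] h(1)
      by (simp add: proj_sec unit_section_def ginv_gmul_cancel)
  qed (simp_all add: rng_rng)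
  then show "convolution G L (unit_section a) (sec F) g = sec (\<lambda>g. complex_of_real (a (rng G g)) * F g) g"
    using val by simp
qed

text \<open>The frame is arbitrary off the units, so the coordinate \<open>F'\<close> has no formula
  in terms of \<open>F\<close>. Its modulus is known, which settles the support; continuity is
  checked on the section itself.\<close>

lemma section_star_in_Gamma_c:
  assumes U: "bisection G U" and F: "F \<in> coordinates U"
  shows "section_star G L (sec F) \<in> Gamma_c L"
proof -
  have "section_star G L (sec F) g \<in> fibre L g" for g
    by (simp add: section_star_def fibre_def proj_lstar proj_sec ginv_ginv)
  then obtain F' where F': "section_star G L (sec F) = sec F'"
    using ex_sec by metis
  have norm: "cmod (F' g) = cmod (F (ginv G g))" for g
    using arg_cong[OF F', of "\<lambda>\<eta>. lnorm L (\<eta> g)"]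
    by (simp add: section_star_def lnorm_lstar lnorm_sec)
  obtain K where K: "continuous_on U (sec F)" "compact K" "K \<subseteq> U" "\<And>g. g \<notin> K \<Longrightarrow> F g = 0"
    using F unfolding coordinates_def by blast
  have "continuous_on (ginv G -` U) (\<lambda>g. lstar L (sec F (ginv G g)))"
    by (intro continuous_on_compose2[OF continuous_lstar] continuous_on_compose2[OF K(1)]
        continuous_on_subset[OF continuous_ginv]) auto
  then have "continuous_on (ginv G -` U) (sec F')"
    unfolding F'[symmetric] section_star_def .
  moreover have "compact (ginv G ` K)"
    using K(2) continuous_ginv compact_continuous_image continuous_on_subset by blast
  moreover have "ginv G ` K \<subseteq> ginv G -` U"
    using K(3) ginv_ginv by auto
  moreover have "F' g = 0" if "g \<notin> ginv G ` K" for g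
    using norm[of g] K(4)[of "ginv G g"] that by (metis ginv_ginv image_eqI norm_eq_zero)
  ultimately have "F' \<in> coordinates (ginv G -` U)"
    by (rule coordinatesI)
  then show ?thesis
    unfolding F' using bisection_ginv[OF U]
    by (intro sec_in_Gamma_c bisection_Hausdorff) (auto simp: bisection_def)
qed

lemma section_star_unit_section:
  assumes a: "a \<in> Cc (gunits G)"
  shows "section_star G L (unit_section a) = unit_section a"
proof
  fix g
  show "section_star G L (unit_section a) g = unit_section a g"
  proof (cases "g \<in> gunits G")
    case True
    then show ?thesis
      by (simp add: section_star_def unit_section_def sec_def gunits_ginv lstar_lscale unit_vector)
  next
    case False
    then have "ginv G g \<notin> gunits G"
      by (metis ginv_ginv gunits_ginv)
    then have "lnorm L (section_star G L (unit_section a) g) = 0"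
      using Cc_outside[OF a] by (simp add: section_star_def unit_section_def lnorm_lstar lnorm_sec)
    then have "section_star G L (unit_section a) g = lzero L g"
      by (simp add: lnorm_eq_0) (simp add: section_star_def unit_section_def proj_lstar proj_sec ginv_ginv)
    moreover have "unit_section a g = lzero L g"
      using Cc_outside[OF a False] by (simp add: unit_section_def sec_eq_lzero_iff)
    ultimately show ?thesis
      by simp
  qed
qed

text \<open>If both factors of a term are nonzero, \<open>ginv G h\<close> and
  \<open>gmul G (ginv G h) g\<close> lie in \<open>U\<close> with equal range, hence coincide, and
  \<open>g\<close> is a unit. This is what turns norms of vectors into functionals on the unit
  space.\<close>

lemma convolution_star_self:
  assumes U: "bisection G U" and F: "\<And>g. g \<notin> U \<Longrightarrow> F g = 0"
  shows "convolution G L (section_star G L (sec F)) (sec F) =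
    unit_section (pushforward (src G) U (\<lambda>g. (cmod (F g))\<^sup>2))"
proof
  fix g
  let ?t = "\<lambda>h. lmul L (section_star G L (sec F) h) (sec F (gmul G (ginv G h) g))"
  let ?p = "pushforward (src G) U (\<lambda>g. (cmod (F g))\<^sup>2)"
  have inj: "inj_on (src G) U" "inj_on (rng G) U"
    using U by (auto simp: bisection_def)
  have pst: "proj L (section_star G L (sec F) h) = h" for h
    by (simp add: section_star_def proj_lstar proj_sec ginv_ginv)
  have zero: "?t h = lzero L g" if "rng G h = rng G g" "F (ginv G h) = 0 \<or> F (gmul G (ginv G h) g) = 0" for h
  proof -
    have c: "composable G (proj L (section_star G L (sec F) h)) (proj L (sec F (gmul G (ginv G h) g)))"
      using that(1) by (simp add: composable_def pst proj_sec rng_ginv_gmul)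
    have "lnorm L (section_star G L (sec F) h) = 0 \<or> lnorm L (sec F (gmul G (ginv G h) g)) = 0"
      using that(2) by (simp add: section_star_def lnorm_lstar lnorm_sec)
    from lmul_eq_lzero[OF c this] show ?thesis
      using that(1) by (simp add: pst proj_sec ginv_gmul_cancel)
  qed
  have unit: "g = rng G g \<and> gmul G (ginv G h) g = ginv G h"
    if h: "rng G h = rng G g" "ginv G h \<in> U" "gmul G (ginv G h) g \<in> U" for h
  proof -
    have "rng G (ginv G h) = rng G (gmul G (ginv G h) g)"
      by (simp add: rng_ginv rng_ginv_gmul[OF h(1)])
    then have eq: "gmul G (ginv G h) g = ginv G h"
      using inj(2) h by (auto dest: inj_onD)
    then have "g = rng G h"
      using ginv_gmul_cancel[OF h(1)] by (simp add: rng_def)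
    then show ?thesis
      using eq h(1) by simp
  qed
  show "convolution G L (section_star G L (sec F)) (sec F) g = unit_section ?p g"
  proof (cases "g \<in> src G ` U")
    case False
    have "?t h = lzero L g" if h: "rng G h = rng G g" for h
    proof (rule zero[OF h], rule ccontr)
      assume "\<not> (F (ginv G h) = 0 \<or> F (gmul G (ginv G h) g) = 0)"
      then have *: "ginv G h \<in> U" "gmul G (ginv G h) g \<in> U"
        using F by blast+
      then have "g = src G (ginv G h)"
        using unit[OF h *] h by (simp add: src_ginv)
      then show False
        using False *(1) by blast
    qed
    then have "convolution G L (section_star G L (sec F)) (sec F) g = lzero L g"
      by (rule convolution_eq_lzero)
    also have "\<dots> = unit_section ?p g"
      using False by (simp add: unit_section_def sec_eq_lzero_iff pushforward_outside eq_commute[of "lzero L g"])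
    finally show ?thesis .
  next
    case True
    then obtain k where k: "k \<in> U" "g = src G k"
      by blast
    have g: "rng G g = g"
      using k by (simp add: rng_src)
    have "gmul G (ginv G (ginv G k)) g = k"
      by (simp add: ginv_ginv k gmul_src)
    then have "?t (ginv G k) = lmul L (lstar L (sec F k)) (sec F k)"
      by (simp add: section_star_def ginv_ginv)
    also have "\<dots> = unit_section ?p g"
      by (simp add: lstar_lmul_self lnorm_sec proj_sec k unit_section_def pushforward_at[OF inj(1) k(1)])
         (simp add: sec_def pushforward_at[OF inj(1) k(1)])
    finally have val: "?t (ginv G k) = unit_section ?p g" .
    have "convolution G L (section_star G L (sec F)) (sec F) g = ?t (ginv G k)"
    proof (rule convolution_eq_term[where t = ?t])
      show "rng G (ginv G k) = rng G g"
        using g k by (simp add: rng_ginv)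
      show "proj L (?t (ginv G k)) = g"
        using val by (simp add: unit_section_def proj_sec)
      fix h assume h: "rng G h = rng G g" "h \<noteq> ginv G k"
      show "?t h = lzero L g"
      proof (rule zero[OF h(1)], rule ccontr)
        assume "\<not> (F (ginv G h) = 0 \<or> F (gmul G (ginv G h) g) = 0)"
        then have *: "ginv G h \<in> U"
          using F by blast
        moreover have "src G (ginv G h) = src G k"
          using h(1) g k by (simp add: src_ginv)
        ultimately have "ginv G h = k"
          using inj(1) k by (auto dest: inj_onD)
        then show False
          using h(2) ginv_ginv by metis
      qed
    qed simp
    then show ?thesis
      using val by simp
  qed
qed

end

section \<open>Estimates for representations\<close>

context pre_hilbert_space
begin

lemma ip_add_right: "ip \<zeta> (\<xi> + \<xi>') = ip \<zeta> \<xi> + ip \<zeta> \<xi>'"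
  by (metis ip_add_left ip_cnj complex_cnj_add)

lemma ip_scale_right: "ip \<zeta> (scaleC c \<xi>) = cnj c * ip \<zeta> \<xi>"
  by (metis ip_scale_left ip_cnj complex_cnj_mult)

lemma ip_diff_left: "ip (\<xi> - \<xi>') \<zeta> = ip \<xi> \<zeta> - ip \<xi>' \<zeta>"
  using ip_add_left[of "\<xi> - \<xi>'" \<xi>' \<zeta>] by simp

lemma ip_diff_right: "ip \<zeta> (\<xi> - \<xi>') = ip \<zeta> \<xi> - ip \<zeta> \<xi>'"
  using ip_add_right[of \<zeta> "\<xi> - \<xi>'" \<xi>'] by simp

lemma ip_zero_left: "ip 0 \<zeta> = 0"
  using ip_diff_left[of 0 0 \<zeta>] by simp

lemma ip_norm_nonneg: "0 \<le> ip_norm ip \<xi>"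
  using ip_nonneg[of \<xi>] by (auto simp: ip_norm_def elim: nonneg_Reals_cases)

lemma ip_norm_square: "(ip_norm ip \<xi>)\<^sup>2 = Re (ip \<xi> \<xi>)"
  using ip_nonneg[of \<xi>] by (auto simp: ip_norm_def elim: nonneg_Reals_cases)

lemma ip_self: "ip \<xi> \<xi> = complex_of_real ((ip_norm ip \<xi>)\<^sup>2)"
  unfolding ip_norm_square using ip_nonneg[of \<xi>] by (auto elim: nonneg_Reals_cases)

text \<open>Expand the squared norm of \<open>\<xi> - scaleC c \<zeta>\<close>, where
  \<open>c\<close> is the phase of \<open>ip \<xi> \<zeta>\<close>. The arithmetic-mean form is
  chosen because it is linear in the squared norms and can be summed over the pieces of a
  decomposition.\<close>

lemma cmod_ip_le: "cmod (ip \<xi> \<zeta>) \<le> ((ip_norm ip \<xi>)\<^sup>2 + (ip_norm ip \<zeta>)\<^sup>2) / 2"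
proof (cases "ip \<xi> \<zeta> = 0")
  case True
  then show ?thesis
    by simp
next
  case False
  define c where "c = ip \<xi> \<zeta> / complex_of_real (cmod (ip \<xi> \<zeta>))"
  have "ip \<xi> \<zeta> * cnj (ip \<xi> \<zeta>) = (complex_of_real (cmod (ip \<xi> \<zeta>)))\<^sup>2"
    using complex_norm_square[of "ip \<xi> \<zeta>"] by simp
  then have c: "cnj c * ip \<xi> \<zeta> = complex_of_real (cmod (ip \<xi> \<zeta>))" "c * cnj c = 1"
    using False by (simp_all add: c_def power2_eq_square mult.commute)
  have "c * ip \<zeta> \<xi> = cnj (cnj c * ip \<xi> \<zeta>)"
    using ip_cnj[of \<xi> \<zeta>] by simp
  then have c': "c * ip \<zeta> \<xi> = complex_of_real (cmod (ip \<xi> \<zeta>))"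
    unfolding c(1) by simp
  have "ip (\<xi> - scaleC c \<zeta>) (\<xi> - scaleC c \<zeta>) =
      ip \<xi> \<xi> - cnj c * ip \<xi> \<zeta> - (c * ip \<zeta> \<xi> - (c * cnj c) * ip \<zeta> \<zeta>)"
    by (simp add: ip_diff_left ip_diff_right ip_scale_left ip_scale_right algebra_simps)
  then have "(ip_norm ip (\<xi> - scaleC c \<zeta>))\<^sup>2 =
      (ip_norm ip \<xi>)\<^sup>2 + (ip_norm ip \<zeta>)\<^sup>2 - 2 * cmod (ip \<xi> \<zeta>)"
    unfolding c c' ip_norm_square by simp
  then show ?thesis
    using zero_le_power2[of "ip_norm ip (\<xi> - scaleC c \<zeta>)"] by simp
qed

end

context Gamma_c_representation
begin

text \<open>The functional \<mu> attached to \<xi>. For \<open>a\<close> in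
  \<open>Cc (gunits G)\<close> the real part loses nothing, since \<open>unit_section a\<close> is
  fixed by the star.\<close>

definition state :: "'h \<Rightarrow> ('g \<Rightarrow> real) \<Rightarrow> real" where
  "state \<xi> a = Re (ip \<xi> (\<pi> (unit_section a) \<xi>))"

lemma state_add:
  assumes "a \<in> Cc (gunits G)" "b \<in> Cc (gunits G)"
  shows "state \<xi> (\<lambda>x. a x + b x) = state \<xi> a + state \<xi> b"
proof -
  have "unit_section (\<lambda>x. a x + b x) = section_add L (unit_section a) (unit_section b)"
    by (simp add: unit_section_def section_add_sec)
  then show ?thesis
    by (simp add: state_def rep_add unit_section_in_Gamma_c assms ip_add_right)
qed

lemma state_cmult:
  assumes "a \<in> Cc (gunits G)"
  shows "state \<xi> (\<lambda>x. c * a x) = c * state \<xi> a"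
proof -
  have "unit_section (\<lambda>x. c * a x) = section_scale L (complex_of_real c) (unit_section a)"
    by (simp add: unit_section_def section_scale_sec)
  then show ?thesis
    by (simp add: state_def rep_scale unit_section_in_Gamma_c assms ip_scale_right)
qed

lemma state_diff:
  assumes "a \<in> Cc (gunits G)" "b \<in> Cc (gunits G)"
  shows "state \<xi> (\<lambda>x. a x - b x) = state \<xi> a - state \<xi> b"
  using state_add[OF assms(1) Cc_cmult[OF assms(2), of "-1"]] state_cmult[OF assms(2), of \<xi> "-1"]
  by simp

lemma state_sum:
  assumes "\<And>i. i \<in> I \<Longrightarrow> a i \<in> Cc (gunits G)"
  shows "state \<xi> (\<lambda>x. \<Sum>i\<in>I. a i x) = (\<Sum>i\<in>I. state \<xi> (a i))"
  using assms
proof (induction I rule: infinite_finite_induct)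
  case (insert i I)
  then show ?case
    by (simp add: state_add Cc_sum)
qed (use state_cmult[OF Cc_zero, of \<xi> 0] in simp_all)

text \<open>Moving one operator across the inner product leaves the convolution of the star of
  \<open>sec F\<close> with \<open>sec F\<close>, which is a function on units because
  \<open>U\<close> is a bisection.\<close>

lemma ip_norm_rep_sec:
  assumes U: "bisection G U" and F: "F \<in> coordinates U"
  shows "(ip_norm ip (\<pi> (sec F) \<xi>))\<^sup>2 = state \<xi> (pushforward (src G) U (\<lambda>g. (cmod (F g))\<^sup>2))"
proof -
  have F\<Gamma>: "sec F \<in> Gamma_c L"
    using U F bisection_Hausdorff by (intro sec_in_Gamma_c) (auto simp: bisection_def)
  have "ip (\<pi> (sec F) \<xi>) (\<pi> (sec F) \<xi>) = ip \<xi> (\<pi> (section_star G L (sec F)) (\<pi> (sec F) \<xi>))"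
    by (rule rep_star[OF F\<Gamma>])
  also have "\<dots> = ip \<xi> (\<pi> (convolution G L (section_star G L (sec F)) (sec F)) \<xi>)"
    by (simp add: rep_convolution section_star_in_Gamma_c[OF U F] F\<Gamma>)
  also have "\<dots> = ip \<xi> (\<pi> (unit_section (pushforward (src G) U (\<lambda>g. (cmod (F g))\<^sup>2))) \<xi>)"
    using coordinates_outside[OF F] by (simp add: convolution_star_self[OF U])
  finally show ?thesis
    by (simp add: ip_norm_square state_def)
qed

text \<open>The preceding identity for the bisection \<open>gunits G\<close>, where the source is
  the identity.\<close>

lemma state_square:
  assumes "a \<in> Cc (gunits G)"
  shows "state \<xi> (\<lambda>x. (a x)\<^sup>2) = (ip_norm ip (\<pi> (unit_section a) \<xi>))\<^sup>2"
proof -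
  let ?p = "pushforward (src G) (gunits G) (\<lambda>x. (cmod (complex_of_real (a x)))\<^sup>2)"
  have p: "?p x = (a x)\<^sup>2" for x
  proof (cases "x \<in> gunits G")
    case True
    then show ?thesis
      using pushforward_at[of "src G" "gunits G" x] bisection_gunits
      by (simp add: bisection_def gunits_src)
  next
    case False
    then show ?thesis
      using Cc_outside[OF assms] src_in_gunits by (subst pushforward_outside) auto
  qed
  show ?thesis
    unfolding unit_section_def ip_norm_rep_sec[OF bisection_gunits Cc_coordinates[OF assms]] p ..
qed

text \<open>A nonnegative function in \<open>Cc (gunits G)\<close> is the square of its square root,
  which is again in it.\<close>

lemma state_nonneg:
  assumes "a \<in> Cc (gunits G)" "\<And>x. 0 \<le> a x"
  shows "0 \<le> state \<xi> a"
proof -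
  have "(\<lambda>x. sqrt (a x)) \<in> Cc (gunits G)"
    by (rule Cc_compose[OF assms(1)]) (auto intro: continuous_on_real_sqrt continuous_on_id)
  from state_square[OF this, of \<xi>] show ?thesis
    using assms(2) by simp
qed

lemma state_mono:
  assumes "a \<in> Cc (gunits G)" "b \<in> Cc (gunits G)" "\<And>x. a x \<le> b x"
  shows "state \<xi> a \<le> state \<xi> b"
  using state_nonneg[OF Cc_diff[OF assms(2,1)], of \<xi>] state_diff[OF assms(2,1), of \<xi>] assms(3)
  by simp

text \<open>
  With \<open>b = 1 - \<surd>(1 - a)\<close>, which unlike \<open>\<surd>(1 - a)\<close> has compact support, \<open>\<parallel>\<xi> - \<pi>(b)\<xi>\<parallel>\<^sup>2 \<ge> 0\<close>
  says that \<open>(\<pi>(a)\<xi>, \<xi>) \<le> \<parallel>\<xi>\<parallel>\<^sup>2\<close>.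
\<close>

lemma state_le_1:
  assumes a: "a \<in> Cc (gunits G)" and a01: "\<And>x. 0 \<le> a x" "\<And>x. a x \<le> 1"
  shows "state \<xi> a \<le> (ip_norm ip \<xi>)\<^sup>2"
proof -
  define b where "b x = 1 - sqrt (1 - a x)" for x
  have b: "b \<in> Cc (gunits G)"
    unfolding b_def
    by (rule Cc_compose[OF a, where \<phi> = "\<lambda>s. 1 - sqrt (1 - s)"])
       (auto intro!: continuous_on_diff continuous_on_real_sqrt continuous_on_const continuous_on_id)
  have b2: "(\<lambda>x. (b x)\<^sup>2) \<in> Cc (gunits G)"
    unfolding power2_eq_square by (intro Cc_mult b)
  have "a = (\<lambda>x. 2 * b x - (b x)\<^sup>2)"
    using a01 by (auto simp: b_def fun_eq_iff power2_eq_square algebra_simps)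
  then have "state \<xi> a = 2 * state \<xi> b - state \<xi> (\<lambda>x. (b x)\<^sup>2)"
    by (simp add: state_diff Cc_cmult b b2 state_cmult)
  moreover have "(ip_norm ip (\<xi> - \<pi> (unit_section b) \<xi>))\<^sup>2 =
      (ip_norm ip \<xi>)\<^sup>2 - 2 * state \<xi> b + state \<xi> (\<lambda>x. (b x)\<^sup>2)"
    using ip_cnj[of \<xi> "\<pi> (unit_section b) \<xi>"]
    by (simp add: state_square[OF b] ip_norm_square state_def ip_diff_left ip_diff_right)
  ultimately show ?thesis
    using zero_le_power2[of "ip_norm ip (\<xi> - \<pi> (unit_section b) \<xi>)"] by linarith
qed

lemma state_le:
  assumes a: "a \<in> Cc (gunits G)" and le: "\<And>x. a x \<le> C" and C: "0 \<le> C"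
  shows "state \<xi> a \<le> C * (ip_norm ip \<xi>)\<^sup>2"
proof (cases "C = 0")
  case True
  then show ?thesis
    using state_mono[OF a Cc_zero, of \<xi>] state_cmult[OF Cc_zero, of \<xi> 0] le by simp
next
  case False
  \<comment> \<open>\<open>state_le_1\<close> wants values between 0 and 1, so negative values are
    cut off before dividing by \<open>C\<close>; the division is why \<open>C = 0\<close> is treated
    apart.\<close>
  let ?a = "\<lambda>x. max (a x) 0"
  have m: "?a \<in> Cc (gunits G)"
    by (rule Cc_compose[OF a]) (auto intro!: continuous_on_max continuous_on_id continuous_on_const)
  have "state \<xi> (\<lambda>x. (1 / C) * ?a x) \<le> (ip_norm ip \<xi>)\<^sup>2"
    by (rule state_le_1[OF Cc_cmult[OF m]]) (use False C le in auto)
  then have "(1 / C) * state \<xi> ?a \<le> (ip_norm ip \<xi>)\<^sup>2"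
    by (simp only: state_cmult[OF m])
  then have "state \<xi> ?a \<le> C * (ip_norm ip \<xi>)\<^sup>2"
    using False C by (simp add: field_simps)
  then show ?thesis
    using state_mono[OF a m, of \<xi>] by simp
qed

text \<open>Factor \<open>F\<close> as \<open>\<surd>\<bar>F\<bar> \<circ> r\<close> times \<open>F / \<surd>\<bar>F\<bar>\<close>; at zeros of \<open>F\<close> the quotient is \<open>0\<close>.\<close>

lemma cmod_ip_rep_le:
  assumes U: "bisection G U" and F: "F \<in> coordinates U"
  shows "cmod (ip (\<pi> (sec F) \<xi>) \<zeta>) \<le>
    (state \<xi> (pushforward (src G) U (\<lambda>g. cmod (F g))) +
     state \<zeta> (pushforward (rng G) U (\<lambda>g. cmod (F g)))) / 2"
proof -
  have U': "open U" "inj_on (src G) U" "inj_on (rng G) U"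
    using U by (auto simp: bisection_def)
  let ?F' = "\<lambda>g. complex_of_real (1 / sqrt (cmod (F g))) * F g"
  have F': "?F' \<in> coordinates U"
    by (rule coordinates_divide_sqrt_norm[OF U'(1) F])
  have F'\<Gamma>: "sec ?F' \<in> Gamma_c L"
    by (rule sec_in_Gamma_c[OF U'(1) bisection_Hausdorff[OF U] F'])
  have nF': "(cmod (?F' g))\<^sup>2 = cmod (F g)" for g
    by (simp add: norm_mult norm_divide real_div_sqrt)
  have sq: "(\<lambda>g. sqrt (cmod (F g))) \<in> Cc U"
    by (rule Cc_compose[OF coordinates_norm_Cc[OF F]])
       (auto intro!: continuous_on_real_sqrt continuous_on_id)
  define a where "a = pushforward (rng G) U (\<lambda>g. sqrt (cmod (F g)))"
  have a: "a \<in> Cc (gunits G)"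
    unfolding a_def by (rule rng.pushforward_Cc[OF U'(1,3) sq])
  have "complex_of_real (a (rng G g)) * ?F' g = F g" for g
  proof (cases "g \<in> U")
    case True
    then show ?thesis
      by (simp add: a_def pushforward_at[OF U'(3)])
  next
    case False
    then show ?thesis
      using coordinates_outside[OF F] by simp
  qed
  then have conv: "convolution G L (unit_section a) (sec ?F') = sec F"
    unfolding convolution_unit_section[OF a] by simp
  \<comment> \<open>Over each \<open>x\<close> there is at most one point of \<open>U\<close>, so
    the square of the fibre sum is the fibre sum of the squares.\<close>
  have a2: "(a x)\<^sup>2 = pushforward (rng G) U (\<lambda>g. cmod (F g)) x" for x
    by (cases "x \<in> rng G ` U") (auto simp: a_def pushforward_at[OF U'(3)] pushforward_outside)
  have "ip (\<pi> (sec F) \<xi>) \<zeta> = ip (\<pi> (unit_section a) (\<pi> (sec ?F') \<xi>)) \<zeta>"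
    by (simp only: conv[symmetric] rep_convolution[OF unit_section_in_Gamma_c[OF a] F'\<Gamma>])
  also have "\<dots> = ip (\<pi> (sec ?F') \<xi>) (\<pi> (unit_section a) \<zeta>)"
    by (simp only: rep_star[OF unit_section_in_Gamma_c[OF a]] section_star_unit_section[OF a])
  finally have "cmod (ip (\<pi> (sec F) \<xi>) \<zeta>) \<le>
      ((ip_norm ip (\<pi> (sec ?F') \<xi>))\<^sup>2 + (ip_norm ip (\<pi> (unit_section a) \<zeta>))\<^sup>2) / 2"
    using cmod_ip_le by simp
  also have "(ip_norm ip (\<pi> (sec ?F') \<xi>))\<^sup>2 = state \<xi> (pushforward (src G) U (\<lambda>g. cmod (F g)))"
    unfolding ip_norm_rep_sec[OF U F'] nF' ..
  also have "(ip_norm ip (\<pi> (unit_section a) \<zeta>))\<^sup>2 = state \<zeta> (pushforward (rng G) U (\<lambda>g. cmod (F g)))"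
    unfolding state_square[OF a, symmetric] a2 ..
  finally show ?thesis .
qed

end

section \<open>Decompositions over bisections\<close>

context fell_line_bundle
begin

text \<open>\<open>Gamma_c\<close> is spanned using open Hausdorff sets, which need not be
  bisections, whereas all estimates are for bisections. Adding one summand at a time lets a finite
  family be read off by induction.\<close>

inductive_set bisection_span :: "('g \<Rightarrow> complex) set" where
  zero: "(\<lambda>g. 0) \<in> bisection_span"
| add: "F \<in> bisection_span \<Longrightarrow> bisection G U \<Longrightarrow> f \<in> coordinates U \<Longrightarrow>
    (\<lambda>g. F g + f g) \<in> bisection_span"

lemma bisection_span_base: "bisection G U \<Longrightarrow> f \<in> coordinates U \<Longrightarrow> f \<in> bisection_span"
  using bisection_span.add[OF bisection_span.zero] by simp

lemma bisection_span_add: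
  assumes "F \<in> bisection_span" "F' \<in> bisection_span"
  shows "(\<lambda>g. F g + F' g) \<in> bisection_span"
  using assms(2)
proof induction
  case (add F' U f)
  have "(\<lambda>g. (F g + F' g) + f g) \<in> bisection_span"
    using add.IH add.hyps(2,3) by (rule bisection_span.add)
  then show ?case
    by (simp add: add.assoc)
qed (use assms(1) in simp)

lemma bisection_span_scale:
  assumes "F \<in> bisection_span"
  shows "(\<lambda>g. c * F g) \<in> bisection_span"
  using assms
proof induction
  case (add F U f)
  have "(\<lambda>g. c * f g) \<in> coordinates U"
    by (rule coordinates_mult[OF add.hyps(3)]) simp
  then have "(\<lambda>g. c * F g + c * f g) \<in> bisection_span"
    using add by (intro bisection_span.add)
  then show ?case
    by (simp add: distrib_left)
qed (simp add: bisection_span.zero)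

lemma bisection_span_finite_sum:
  assumes "F \<in> bisection_span"
  obtains n :: nat and U f where "\<And>i. i < n \<Longrightarrow> bisection G (U i)" "\<And>i. i < n \<Longrightarrow> f i \<in> coordinates (U i)"
    "F = (\<lambda>g. \<Sum>i<n. f i g)"
proof -
  have "\<exists>(n::nat) U f. (\<forall>i<n. bisection G (U i) \<and> f i \<in> coordinates (U i)) \<and> F = (\<lambda>g. \<Sum>i<n. f i g)"
    using assms
  proof induction
    case zero
    show ?case
      by (intro exI[of _ 0]) simp
  next
    case (add F V k)
    then obtain n :: nat and U f where n: "\<forall>i<n. bisection G (U i) \<and> f i \<in> coordinates (U i)"
        "F = (\<lambda>g. \<Sum>i<n. f i g)"
      by blast
    have eq: "(\<lambda>g. F g + k g) = (\<lambda>g. \<Sum>i<Suc n. (f(n := k)) i g)"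
      by (simp add: n(2))
    have bis: "\<forall>i<Suc n. bisection G ((U(n := V)) i) \<and> (f(n := k)) i \<in> coordinates ((U(n := V)) i)"
      using n(1) add.hyps by (simp add: less_Suc_eq)
    show ?case
      by (rule exI[of _ "Suc n"], rule exI[of _ "U(n := V)"], rule exI[of _ "f(n := k)"])
         (intro conjI bis eq)
  qed
  then show thesis
    using that by blast
qed

text \<open>A telescoping substitute for a partition of unity: split off
  \<open>\<phi> t * F\<close>, supported in \<open>V t\<close>. The remainder
  \<open>(1 - \<phi> t) * F\<close> vanishes wherever \<open>\<phi> t = 1\<close>, so the other
  cutoffs suffice for it.\<close>

lemma bisection_span_if_covered:
  assumes "finite T" "open U" "Hausdorff_space (top_of_set U)" "F \<in> coordinates U"
    and "\<And>t. t \<in> T \<Longrightarrow> bisection G (V t) \<and> V t \<subseteq> U \<and> \<phi> t \<in> Cc (V t)"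
    and "\<And>g. F g \<noteq> 0 \<Longrightarrow> \<exists>t\<in>T. \<phi> t g = (1::real)"
  shows "F \<in> bisection_span"
  using assms(1,4-)
proof (induction T arbitrary: F rule: finite_induct)
  case empty
  then have "F = (\<lambda>g. 0)"
    by auto
  then show ?case
    by (simp add: bisection_span.zero)
next
  case (insert t T)
  have t: "bisection G (V t)" "V t \<subseteq> U" "\<phi> t \<in> Cc (V t)"
    using insert.prems(2)[of t] by auto
  then have "\<phi> t \<in> Cc U"
    using Cc_mono assms(2,3) unfolding bisection_def by blast
  then have c: "continuous_on U (\<lambda>g. complex_of_real (1 - \<phi> t g))"
    by (intro continuous_on_of_real continuous_on_diff continuous_on_const Cc_continuous)
  have "(\<lambda>g. complex_of_real (\<phi> t g) * F g) \<in> coordinates (V t)"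
    by (rule coordinates_Cc_mult[OF t(3)])
       (rule continuous_on_subset[OF coordinates_continuous[OF insert.prems(1)] t(2)])
  then have 1: "(\<lambda>g. complex_of_real (\<phi> t g) * F g) \<in> bisection_span"
    using t(1) by (intro bisection_span_base)
  have 2: "(\<lambda>g. complex_of_real (1 - \<phi> t g) * F g) \<in> bisection_span"
  proof (rule insert.IH)
    show "(\<lambda>g. complex_of_real (1 - \<phi> t g) * F g) \<in> coordinates U"
      by (rule coordinates_mult[OF insert.prems(1) c])
    show "\<exists>s\<in>T. \<phi> s g = 1" if "complex_of_real (1 - \<phi> t g) * F g \<noteq> 0" for g
      using insert.prems(3)[of g] that by auto
  qed (use insert.prems in auto)
  show ?case
    using bisection_span_add[OF 1 2] by (simp add: algebra_simps)
qed

lemma coordinates_bisection_span: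
  assumes U: "open U" "Hausdorff_space (top_of_set U)" and F: "F \<in> coordinates U"
  shows "F \<in> bisection_span"
proof -
  obtain K where K: "compact K" "K \<subseteq> U" "\<And>g. g \<notin> K \<Longrightarrow> F g = 0"
    using F unfolding coordinates_def by blast
  have "\<exists>V \<phi> N. bisection G V \<and> V \<subseteq> U \<and> \<phi> \<in> Cc V \<and> open N \<and> g \<in> N \<and> (\<forall>y\<in>N. \<phi> y = (1::real))"
    if "g \<in> K" for g
  proof -
    obtain W where W: "bisection G W" "g \<in> W"
      using bisection_neighbourhood .
    have V: "bisection G (W \<inter> U)"
      using W(1) U(1) by (intro bisection_subset[OF W(1)]) (auto simp: bisection_def)
    have g: "g \<in> W \<inter> U"
      using W that K by blast
    obtain \<phi> N where "\<phi> \<in> Cc (W \<inter> U)" "open N" "g \<in> N" "\<And>y. y \<in> N \<Longrightarrow> \<phi> y = 1"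
      using src.bump[of "W \<inter> U" g] V g unfolding bisection_def by metis
    then show ?thesis
      using V by blast
  qed
  then obtain V \<phi> N where N: "\<And>g. g \<in> K \<Longrightarrow> bisection G (V g) \<and> V g \<subseteq> U \<and> \<phi> g \<in> Cc (V g)"
      "\<And>g. g \<in> K \<Longrightarrow> open (N g)" "\<And>g. g \<in> K \<Longrightarrow> g \<in> N g"
      "\<And>g y. g \<in> K \<Longrightarrow> y \<in> N g \<Longrightarrow> \<phi> g y = (1::real)"
    by metis
  obtain T where T: "T \<subseteq> K" "finite T" "K \<subseteq> (\<Union>g\<in>T. N g)"
    using compactE_image[OF K(1), of K N] N(2,3) by blast
  show ?thesis
  proof (rule bisection_span_if_covered[OF T(2) U F])
    show "bisection G (V t) \<and> V t \<subseteq> U \<and> \<phi> t \<in> Cc (V t)" if "t \<in> T" for t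
      using N(1) T(1) that by blast
    show "\<exists>t\<in>T. \<phi> t g = 1" if "F g \<noteq> 0" for g
      using K(3)[of g] that T N(4) by blast
  qed
qed

lemma Gamma_c_bisection_span:
  assumes "\<eta> \<in> Gamma_c L"
  obtains F where "F \<in> bisection_span" "\<eta> = sec F"
proof -
  have "\<exists>F. F \<in> bisection_span \<and> \<eta> = sec F"
    using assms
  proof induction
    case (base U \<eta>)
    from base(3) obtain F where "F \<in> coordinates U" "\<eta> = sec F"
      by (rule Gamma_c_on_sec)
    then show ?case
      using coordinates_bisection_span[OF base(1,2)] by blast
  next
    case (add \<eta> \<zeta>)
    then obtain F F' where "F \<in> bisection_span" "\<eta> = sec F" "F' \<in> bisection_span" "\<zeta> = sec F'"
      by blast
    then show ?case
      using bisection_span_add[of F F'] section_add_sec[of F F'] by blast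
  next
    case (scale \<eta> c)
    then obtain F where "F \<in> bisection_span" "\<eta> = sec F"
      by blast
    then show ?case
      using bisection_span_scale[of F c] section_scale_sec[of c F] by blast
  qed
  then show thesis
    using that by blast
qed

end

text \<open>At \<open>g\<close>, let \<open>J\<close> consist of all indices whose set contains
  \<open>g\<close>: the moduli then exceed the modulus of the sum by exactly the term for this
  \<open>J\<close>. The remaining nonempty \<open>J\<close> only add nonnegative terms. Full
  intersections are used because, unlike the sets of points lying in exactly the \<open>U j\<close>
  with \<open>j \<in> J\<close>, they are open for open \<open>U j\<close>.\<close>

lemma finite_fibre_sum_le:
  fixes f :: "'i \<Rightarrow> 'a \<Rightarrow> complex"
  assumes I: "finite I" and inj: "\<And>i. i \<in> I \<Longrightarrow> inj_on t (U i)"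
    and f: "\<And>i g. i \<in> I \<Longrightarrow> g \<notin> U i \<Longrightarrow> f i g = 0"
    and M: "\<And>B. finite B \<Longrightarrow> B \<subseteq> {g. t g = x} \<Longrightarrow> (\<Sum>g\<in>B. cmod (\<Sum>i\<in>I. f i g)) \<le> M"
  shows "(\<Sum>i\<in>I. pushforward t (U i) (\<lambda>g. cmod (f i g)) x) \<le>
    M + (\<Sum>J\<in>Pow I - {{}}. pushforward t (\<Inter>j\<in>J. U j)
      (\<lambda>g. (\<Sum>j\<in>J. cmod (f j g)) - cmod (\<Sum>j\<in>J. f j g)) x)"
proof -
  define B where "B = (\<Union>i\<in>I. {g \<in> U i. t g = x})"
  define D where "D J g = (\<Sum>j\<in>J. cmod (f j g)) - cmod (\<Sum>j\<in>J. f j g)" for J g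
  let ?P = "Pow I - {{}}"
  have finB: "finite B"
    unfolding B_def by (intro finite_UN_I I inj_on_fibre_finite inj)
  have D_nonneg: "0 \<le> D J g" for J g
    by (simp add: D_def norm_sum)
  have "(\<Sum>i\<in>I. pushforward t (U i) (\<lambda>g. cmod (f i g)) x) = (\<Sum>i\<in>I. \<Sum>g\<in>B. cmod (f i g))"
    unfolding pushforward_def
    by (intro sum.cong refl sum.mono_neutral_left finB) (use f in \<open>auto simp: B_def\<close>)
  also have "\<dots> = (\<Sum>g\<in>B. \<Sum>i\<in>I. cmod (f i g))"
    by (rule sum.swap)
  also have "\<dots> \<le> (\<Sum>g\<in>B. cmod (\<Sum>i\<in>I. f i g) + (\<Sum>J\<in>?P. if g \<in> (\<Inter>j\<in>J. U j) then D J g else 0))"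
  proof (rule sum_mono)
    fix g assume g: "g \<in> B"
    define J where "J = {i \<in> I. g \<in> U i}"
    have J: "J \<in> ?P" "g \<in> (\<Inter>j\<in>J. U j)"
      using g by (auto simp: J_def B_def)
    have "(\<Sum>i\<in>I. f i g) = (\<Sum>i\<in>J. f i g)" "(\<Sum>i\<in>I. cmod (f i g)) = (\<Sum>i\<in>J. cmod (f i g))"
      by (rule sum.mono_neutral_right[OF I]; use f in \<open>auto simp: J_def\<close>)+
    then have "(\<Sum>i\<in>I. cmod (f i g)) = cmod (\<Sum>i\<in>I. f i g) + D J g"
      by (simp add: D_def)
    moreover have "D J g \<le> (\<Sum>J\<in>?P. if g \<in> (\<Inter>j\<in>J. U j) then D J g else 0)"
      using member_le_sum[of J ?P "\<lambda>J. if g \<in> (\<Inter>j\<in>J. U j) then D J g else 0"] J I D_nonneg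
      by (simp only: if_True finite_Diff finite_Pow_iff) auto
    ultimately show "(\<Sum>i\<in>I. cmod (f i g)) \<le>
        cmod (\<Sum>i\<in>I. f i g) + (\<Sum>J\<in>?P. if g \<in> (\<Inter>j\<in>J. U j) then D J g else 0)"
      by simp
  qed
  also have "\<dots> = (\<Sum>g\<in>B. cmod (\<Sum>i\<in>I. f i g)) +
      (\<Sum>J\<in>?P. \<Sum>g\<in>B. if g \<in> (\<Inter>j\<in>J. U j) then D J g else 0)"
    unfolding sum.distrib by (rule arg_cong[OF sum.swap])
  also have "(\<Sum>J\<in>?P. \<Sum>g\<in>B. if g \<in> (\<Inter>j\<in>J. U j) then D J g else 0) =
      (\<Sum>J\<in>?P. pushforward t (\<Inter>j\<in>J. U j) (D J) x)"
  proof (rule sum.cong[OF refl])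
    fix J assume "J \<in> ?P"
    then have "{g \<in> (\<Inter>j\<in>J. U j). t g = x} = {g \<in> B. g \<in> (\<Inter>j\<in>J. U j)}"
      by (auto simp: B_def)
    then show "(\<Sum>g\<in>B. if g \<in> (\<Inter>j\<in>J. U j) then D J g else 0) = pushforward t (\<Inter>j\<in>J. U j) (D J) x"
      unfolding pushforward_def by (simp add: sum.inter_filter[OF finB])
  qed
  also have "(\<Sum>g\<in>B. cmod (\<Sum>i\<in>I. f i g)) \<le> M"
    by (rule M[OF finB]) (auto simp: B_def)
  finally show ?thesis
    unfolding D_def by simp
qed

section \<open>Costs of functions on bisections\<close>

context Gamma_c_representation
begin

text \<open>For \<open>h\<close> the modulus of a coordinate this is twice the bound in
  \<open>cmod_ip_rep_le\<close>.\<close>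

definition cost :: "'h \<Rightarrow> 'h \<Rightarrow> 'g set \<Rightarrow> ('g \<Rightarrow> real) \<Rightarrow> real" where
  "cost \<xi> \<zeta> U h = state \<xi> (pushforward (src G) U h) + state \<zeta> (pushforward (rng G) U h)"

lemma bisection_pushforward_Cc:
  assumes "bisection G U" "h \<in> Cc U"
  shows "pushforward (src G) U h \<in> Cc (gunits G)" "pushforward (rng G) U h \<in> Cc (gunits G)"
  using assms src.pushforward_Cc rng.pushforward_Cc unfolding bisection_def by blast+

lemma cost_add:
  assumes "bisection G U" "h \<in> Cc U" "k \<in> Cc U"
  shows "cost \<xi> \<zeta> U (\<lambda>g. h g + k g) = cost \<xi> \<zeta> U h + cost \<xi> \<zeta> U k"
  unfolding cost_def pushforward_add
  by (simp add: state_add bisection_pushforward_Cc assms)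

lemma cost_diff:
  assumes "bisection G U" "h \<in> Cc U" "k \<in> Cc U"
  shows "cost \<xi> \<zeta> U (\<lambda>g. h g - k g) = cost \<xi> \<zeta> U h - cost \<xi> \<zeta> U k"
  unfolding cost_def pushforward_diff
  by (simp add: state_diff bisection_pushforward_Cc assms)

lemma cost_sum:
  assumes "bisection G U" "\<And>i. i \<in> I \<Longrightarrow> h i \<in> Cc U"
  shows "cost \<xi> \<zeta> U (\<lambda>g. \<Sum>i\<in>I. h i g) = (\<Sum>i\<in>I. cost \<xi> \<zeta> U (h i))"
  unfolding cost_def pushforward_sum
  by (simp add: state_sum bisection_pushforward_Cc assms sum.distrib)

lemma cost_mono:
  assumes "bisection G U" "h \<in> Cc U" "k \<in> Cc U" "\<And>g. h g \<le> k g"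
  shows "cost \<xi> \<zeta> U h \<le> cost \<xi> \<zeta> U k"
  unfolding cost_def
  by (intro add_mono state_mono bisection_pushforward_Cc pushforward_mono assms)

lemma cost_nonneg:
  assumes "bisection G U" "h \<in> Cc U" "\<And>g. 0 \<le> h g"
  shows "0 \<le> cost \<xi> \<zeta> U h"
  unfolding cost_def
  by (intro add_nonneg_nonneg state_nonneg bisection_pushforward_Cc pushforward_nonneg assms)

lemma cost_subset:
  assumes "bisection G U" "V \<subseteq> U" "h \<in> Cc V"
  shows "cost \<xi> \<zeta> U h = cost \<xi> \<zeta> V h"
proof -
  have "pushforward t V h = pushforward t U h" if "inj_on t U" for t :: "'g \<Rightarrow> 'g"
    using pushforward_subset[OF that assms(2)] Cc_outside[OF assms(3)] by (intro ext) auto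
  then show ?thesis
    using assms(1) by (simp add: cost_def bisection_def)
qed

lemma ip_sum_left: "ip (\<Sum>i\<in>I. v i) \<zeta> = (\<Sum>i\<in>I. ip (v i) \<zeta>)"
  by (induction I rule: infinite_finite_induct) (auto simp: ip_zero_left ip_add_left)

lemma rep_sec_sum:
  assumes "finite I" "\<And>i. i \<in> I \<Longrightarrow> sec (f i) \<in> Gamma_c L"
  shows "sec (\<lambda>g. \<Sum>i\<in>I. f i g) \<in> Gamma_c L \<and> \<pi> (sec (\<lambda>g. \<Sum>i\<in>I. f i g)) \<xi> = (\<Sum>i\<in>I. \<pi> (sec (f i)) \<xi>)"
  using assms
proof (induction I rule: finite_induct)
  case empty
  have z: "sec (\<lambda>g. 0) \<in> Gamma_c L"
    by (rule sec_in_Gamma_c[OF open_gunits Hausdorff_units coordinates_zero])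
  have "\<pi> (sec (\<lambda>g. 0)) \<xi> = scaleC 0 (\<pi> (sec (\<lambda>g. 0)) \<xi>)"
    using rep_scale[OF z, of 0 \<xi>] section_scale_sec[of 0 "\<lambda>g. 0"] by simp
  then show ?case
    using z by simp
next
  case (insert i I)
  have "sec (\<lambda>g. \<Sum>i\<in>insert i I. f i g) = section_add L (sec (f i)) (sec (\<lambda>g. \<Sum>i\<in>I. f i g))"
    using insert.hyps by (simp add: section_add_sec)
  then show ?case
    using insert by (simp add: rep_add Gamma_c.add)
qed

end

text \<open>The cover stays fixed while decompositions vary, so transfers never change the finite
  family of overlaps.\<close>

locale bisection_cover = Gamma_c_representation G L scaleC ip \<pi>
  for G :: "'g::topological_space groupoid_struct"
    and L :: "('g, 'l::topological_space) fell_bundle_struct"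
    and scaleC :: "complex \<Rightarrow> 'h::ab_group_add \<Rightarrow> 'h"
    and ip :: "'h \<Rightarrow> 'h \<Rightarrow> complex"
    and \<pi> :: "('g \<Rightarrow> 'l) \<Rightarrow> 'h \<Rightarrow> 'h" +
  fixes I :: "'i set" and U :: "'i \<Rightarrow> 'g set"
  assumes finite_index: "finite I"
    and bisection_cover: "i \<in> I \<Longrightarrow> bisection G (U i)"
begin

text \<open>Empty \<open>J\<close> would give the whole space, in general no bisection; hence the
  index set \<open>Pow I - {{}}\<close> below.\<close>

definition overlap :: "'i set \<Rightarrow> 'g set" where
  "overlap J = (\<Inter>j\<in>J. U j)"

text \<open>The loss in the triangle inequality, a measure of the cancellation among the terms of
  \<open>J\<close>.\<close>

definition defect :: "('i \<Rightarrow> 'g \<Rightarrow> complex) \<Rightarrow> 'i set \<Rightarrow> 'g \<Rightarrow> real" where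
  "defect f J g = (\<Sum>j\<in>J. cmod (f j g)) - cmod (\<Sum>j\<in>J. f j g)"

definition decompositions :: "('g \<Rightarrow> complex) \<Rightarrow> ('i \<Rightarrow> 'g \<Rightarrow> complex) set" where
  "decompositions F = {f. (\<forall>i\<in>I. f i \<in> coordinates (U i)) \<and> (\<forall>g. (\<Sum>i\<in>I. f i g) = F g)}"

definition total_cost :: "'h \<Rightarrow> 'h \<Rightarrow> ('i \<Rightarrow> 'g \<Rightarrow> complex) \<Rightarrow> real" where
  "total_cost \<xi> \<zeta> f = (\<Sum>i\<in>I. cost \<xi> \<zeta> (U i) (\<lambda>g. cmod (f i g)))"

lemma decompositions_coordinates: "f \<in> decompositions F \<Longrightarrow> i \<in> I \<Longrightarrow> f i \<in> coordinates (U i)"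
  by (simp add: decompositions_def)

lemma overlap_bisection:
  assumes "J \<in> Pow I - {{}}"
  shows "bisection G (overlap J)"
proof -
  obtain j where j: "j \<in> J" "j \<in> I"
    using assms by blast
  have "open (overlap J)"
    unfolding overlap_def using assms finite_index bisection_cover
    by (intro open_INT) (auto simp: bisection_def intro: finite_subset)
  then show ?thesis
    using bisection_subset[OF bisection_cover[OF j(2)]] j(1) by (auto simp: overlap_def)
qed

lemma defect_nonneg: "0 \<le> defect f J g"
  by (simp add: defect_def norm_sum)

lemma overlap_continuous:
  assumes f: "f \<in> decompositions F" and J: "J \<subseteq> I"
  shows "j \<in> J \<Longrightarrow> continuous_on (overlap J) (\<lambda>g. cmod (f j g))"
    and "continuous_on (overlap J) (sec (\<lambda>g. \<Sum>j\<in>J. f j g))"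
    and "continuous_on (overlap J) (defect f J)"
proof -
  have c: "continuous_on (overlap J) (sec (f j))" if "j \<in> J" for j
  proof (rule continuous_on_subset)
    show "continuous_on (U j) (sec (f j))"
      using that J by (intro coordinates_continuous decompositions_coordinates[OF f]) auto
    show "overlap J \<subseteq> U j"
      using that by (auto simp: overlap_def)
  qed
  then show n: "continuous_on (overlap J) (\<lambda>g. cmod (f j g))" if "j \<in> J" for j
    using that by (intro continuous_on_sec_norm)
  show s: "continuous_on (overlap J) (sec (\<lambda>g. \<Sum>j\<in>J. f j g))"
    by (intro continuous_on_sec_sum c)
  have "continuous_on (overlap J) (\<lambda>g. (\<Sum>j\<in>J. cmod (f j g)) - cmod (\<Sum>j\<in>J. f j g))"
    by (intro continuous_on_diff continuous_on_sum n continuous_on_sec_norm[OF s])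
  then show "continuous_on (overlap J) (defect f J)"
    by (simp add: defect_def[abs_def])
qed

text \<open>Moving the part \<open>h f\<^sub>j\<close> of every \<open>f\<^sub>j\<close> with \<open>j \<in> J\<close> into one fixed term removes \<open>h\<close> times the defect.\<close>

lemma transfer:
  assumes f: "f \<in> decompositions F" and J: "J \<in> Pow I - {{}}"
    and h: "h \<in> Cc (overlap J)" and h01: "\<And>g. 0 \<le> h g" "\<And>g. h g \<le> 1"
  obtains f' where "f' \<in> decompositions F"
    "total_cost \<xi> \<zeta> f' \<le> total_cost \<xi> \<zeta> f - cost \<xi> \<zeta> (overlap J) (\<lambda>g. h g * defect f J g)"
proof -
  obtain j0 where j0: "j0 \<in> J"
    using J by blast
  have JI: "J \<subseteq> I" and finJ: "finite J"
    using J finite_index by (auto intro: finite_subset)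
  let ?V = "overlap J"
  have V: "bisection G ?V"
    by (rule overlap_bisection[OF J])
  have VU: "?V \<subseteq> U j" if "j \<in> J" for j
    using that by (auto simp: overlap_def)
  have U: "bisection G (U j)" "open (U j)" "Hausdorff_space (top_of_set (U j))" if "j \<in> J" for j
    using that JI bisection_cover bisection_Hausdorff unfolding bisection_def by blast+
  have oV: "open ?V"
    using V by (simp add: bisection_def)
  have hU: "h \<in> Cc (U j)" if "j \<in> J" for j
    using Cc_mono[OF h oV VU U(2,3)] that by blast
  define S where "S g = (\<Sum>j\<in>J. f j g)" for g
  have Sc: "continuous_on ?V (sec S)"
    using overlap_continuous(2)[OF f JI] by (simp add: S_def[abs_def])
  \<comment> \<open>\<open>S\<close> is known to have a continuous section only on the overlap; the
    cutoff \<open>h\<close>, compactly supported there, allows extension by zero to the larger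
    bisection of \<open>j0\<close>.\<close>
  have hS: "(\<lambda>g. complex_of_real (h g) * S g) \<in> coordinates ?V"
    by (rule coordinates_Cc_mult[OF h Sc])
  define f' where "f' i g = (if i \<in> J then complex_of_real (1 - h g) * f i g +
      (if i = j0 then complex_of_real (h g) * S g else 0) else f i g)" for i g
  have f'_coord: "f' i \<in> coordinates (U i)" if i: "i \<in> I" for i
  proof (cases "i \<in> J")
    case True
    have "(\<lambda>g. complex_of_real (1 - h g) * f i g) \<in> coordinates (U i)"
      by (intro coordinates_mult decompositions_coordinates[OF f i] continuous_on_of_real
          continuous_on_diff continuous_on_const Cc_continuous[OF hU[OF True]])
    moreover have "(\<lambda>g. if i = j0 then complex_of_real (h g) * S g else 0) \<in> coordinates (U i)"
      using coordinates_mono[OF hS oV VU U(2,3)] coordinates_zero[of "U i"] True by (cases "i = j0") auto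
    ultimately have "(\<lambda>g. complex_of_real (1 - h g) * f i g +
        (if i = j0 then complex_of_real (h g) * S g else 0)) \<in> coordinates (U i)"
      by (rule coordinates_add)
    then show ?thesis
      using True by (simp add: f'_def[abs_def])
  next
    case False
    then show ?thesis
      using decompositions_coordinates[OF f i] by (simp add: f'_def[abs_def])
  qed
  have sum_f': "(\<Sum>i\<in>I. f' i g) = F g" for g
  proof -
    have split: "sum k I = sum k (I - J) + sum k J" for k :: "'i \<Rightarrow> complex"
      by (rule sum.subset_diff[OF JI finite_index])
    have "(\<Sum>i\<in>J. f' i g) = (\<Sum>i\<in>J. complex_of_real (1 - h g) * f i g +
        (if i = j0 then complex_of_real (h g) * S g else 0))"
      by (rule sum.cong) (auto simp: f'_def)
    also have "\<dots> = complex_of_real (1 - h g) * S g + complex_of_real (h g) * S g"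
      using j0 finJ by (simp add: sum.distrib S_def sum_distrib_left)
    also have "\<dots> = (\<Sum>i\<in>J. f i g)"
      by (simp add: algebra_simps S_def)
    finally have "(\<Sum>i\<in>J. f' i g) = (\<Sum>i\<in>J. f i g)" .
    moreover have "(\<Sum>i\<in>I - J. f' i g) = (\<Sum>i\<in>I - J. f i g)"
      by (rule sum.cong) (auto simp: f'_def)
    ultimately have "(\<Sum>i\<in>I. f' i g) = (\<Sum>i\<in>I. f i g)"
      using split by simp
    then show ?thesis
      using f by (simp add: decompositions_def)
  qed
  let ?c = "\<lambda>i k. cost \<xi> \<zeta> (U i) k"
  have hf: "(\<lambda>g. h g * cmod (f j g)) \<in> Cc ?V" if "j \<in> J" for j
    by (rule Cc_mult_continuous(1)[OF h overlap_continuous(1)[OF f JI that]])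
  have hnS: "(\<lambda>g. h g * cmod (S g)) \<in> Cc ?V"
    by (rule Cc_mult_continuous(1)[OF h continuous_on_sec_norm[OF Sc]])
  \<comment> \<open>Every term of \<open>J\<close> loses \<open>h\<close> times its modulus, and
    \<open>j0\<close> gains at most \<open>h\<close> times the modulus of \<open>S\<close>. The
    triangle inequality is used for \<open>j0\<close> only.\<close>
  have each: "?c j (\<lambda>g. cmod (f' j g)) \<le> ?c j (\<lambda>g. cmod (f j g)) - cost \<xi> \<zeta> ?V (\<lambda>g. h g * cmod (f j g)) +
      (if j = j0 then cost \<xi> \<zeta> ?V (\<lambda>g. h g * cmod (S g)) else 0)" if j: "j \<in> J" for j
  proof -
    have jI: "j \<in> I"
      using j JI by blast
    have n: "(\<lambda>g. cmod (f j g)) \<in> Cc (U j)" "(\<lambda>g. cmod (f' j g)) \<in> Cc (U j)"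
      using decompositions_coordinates[OF f jI] f'_coord[OF jI] by (simp_all add: coordinates_norm_Cc)
    have hfU: "(\<lambda>g. h g * cmod (f j g)) \<in> Cc (U j)"
      using Cc_mono[OF hf[OF j] oV VU U(2,3)] j by blast
    have hnSU: "(\<lambda>g. h g * cmod (S g)) \<in> Cc (U j)"
      using Cc_mono[OF hnS oV VU U(2,3)] j by blast
    have le: "cmod (complex_of_real (1 - h g) * f j g) = cmod (f j g) - h g * cmod (f j g)"
        "cmod (complex_of_real (h g) * S g) = h g * cmod (S g)" for g
      using h01[of g] unfolding norm_mult norm_of_real by (simp_all add: left_diff_distrib)
    show ?thesis
    proof (cases "j = j0")
      case True
      have "cmod (f' j g) \<le> (cmod (f j g) - h g * cmod (f j g)) + h g * cmod (S g)" for g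
      proof -
        have "f' j g = complex_of_real (1 - h g) * f j g + complex_of_real (h g) * S g"
          unfolding f'_def using j True by simp
        then show ?thesis
          using norm_triangle_ineq[of "complex_of_real (1 - h g) * f j g" "complex_of_real (h g) * S g"]
          by (simp only: le)
      qed
      then have "?c j (\<lambda>g. cmod (f' j g)) \<le> ?c j (\<lambda>g. (cmod (f j g) - h g * cmod (f j g)) + h g * cmod (S g))"
        by (intro cost_mono U(1)[OF j] n Cc_add Cc_diff hfU hnSU)
      also have "\<dots> = ?c j (\<lambda>g. cmod (f j g)) - cost \<xi> \<zeta> ?V (\<lambda>g. h g * cmod (f j g)) +
          cost \<xi> \<zeta> ?V (\<lambda>g. h g * cmod (S g))"
        by (simp add: cost_add cost_diff U(1)[OF j] n hfU hnSU Cc_diff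
            cost_subset[OF U(1)[OF j] VU[OF j] hf[OF j]] cost_subset[OF U(1)[OF j] VU[OF j] hnS])
      finally show ?thesis
        using True by simp
    next
      case False
      have "cmod (f' j g) = cmod (f j g) - h g * cmod (f j g)" for g
        using j False by (simp only: le f'_def if_True if_False add_0_right)
      then show ?thesis
        using False by (simp add: cost_diff U(1)[OF j] n hfU cost_subset[OF U(1)[OF j] VU[OF j] hf[OF j]])
    qed
  qed
  have "(\<Sum>j\<in>J. ?c j (\<lambda>g. cmod (f' j g))) \<le> (\<Sum>j\<in>J. ?c j (\<lambda>g. cmod (f j g)) -
      cost \<xi> \<zeta> ?V (\<lambda>g. h g * cmod (f j g)) + (if j = j0 then cost \<xi> \<zeta> ?V (\<lambda>g. h g * cmod (S g)) else 0))"
    by (rule sum_mono[OF each])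
  also have "\<dots> = (\<Sum>j\<in>J. ?c j (\<lambda>g. cmod (f j g))) - (\<Sum>j\<in>J. cost \<xi> \<zeta> ?V (\<lambda>g. h g * cmod (f j g))) +
      cost \<xi> \<zeta> ?V (\<lambda>g. h g * cmod (S g))"
    using j0 finJ by (simp add: sum.distrib sum_subtractf)
  also have "(\<Sum>j\<in>J. cost \<xi> \<zeta> ?V (\<lambda>g. h g * cmod (f j g))) = cost \<xi> \<zeta> ?V (\<lambda>g. \<Sum>j\<in>J. h g * cmod (f j g))"
    by (rule cost_sum[symmetric, OF V hf])
  also have "(\<Sum>j\<in>J. ?c j (\<lambda>g. cmod (f j g))) - cost \<xi> \<zeta> ?V (\<lambda>g. \<Sum>j\<in>J. h g * cmod (f j g)) +
      cost \<xi> \<zeta> ?V (\<lambda>g. h g * cmod (S g)) =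
      (\<Sum>j\<in>J. ?c j (\<lambda>g. cmod (f j g))) - cost \<xi> \<zeta> ?V (\<lambda>g. (\<Sum>j\<in>J. h g * cmod (f j g)) - h g * cmod (S g))"
    by (simp add: cost_diff V hnS Cc_sum hf)
  also have "(\<lambda>g. (\<Sum>j\<in>J. h g * cmod (f j g)) - h g * cmod (S g)) = (\<lambda>g. h g * defect f J g)"
    by (simp add: defect_def S_def right_diff_distrib sum_distrib_left)
  finally have J_le: "(\<Sum>j\<in>J. ?c j (\<lambda>g. cmod (f' j g))) \<le>
      (\<Sum>j\<in>J. ?c j (\<lambda>g. cmod (f j g))) - cost \<xi> \<zeta> ?V (\<lambda>g. h g * defect f J g)" .
  have "(\<Sum>i\<in>I - J. ?c i (\<lambda>g. cmod (f' i g))) = (\<Sum>i\<in>I - J. ?c i (\<lambda>g. cmod (f i g)))"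
    by (rule sum.cong) (auto simp: f'_def)
  with J_le have "total_cost \<xi> \<zeta> f' \<le> total_cost \<xi> \<zeta> f - cost \<xi> \<zeta> ?V (\<lambda>g. h g * defect f J g)"
    unfolding total_cost_def sum.subset_diff[OF JI finite_index] by simp
  moreover have "f' \<in> decompositions F"
    using f'_coord sum_f' by (simp add: decompositions_def)
  ultimately show thesis
    using that by blast
qed

text \<open>A general \<open>t\<close> serves both the source with \<xi> and the range with \<zeta>.
  \<open>finite_fibre_sum_le\<close> bounds the fibre sums by \<open>M\<close> plus uncut defects;
  replacing these by cut-off ones costs \<delta>, and each cut-off defect has state at most
  \<epsilon>.\<close>

lemma state_pushforward_sum_le:
  assumes t: "etale_map t (gunits G)" and inj: "\<And>i. i \<in> I \<Longrightarrow> inj_on t (U i)"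
    and f: "f \<in> decompositions F" and \<xi>: "ip_norm ip \<xi> \<le> 1"
    and M: "\<And>x B. finite B \<Longrightarrow> B \<subseteq> {g. t g = x} \<Longrightarrow> (\<Sum>g\<in>B. cmod (F g)) \<le> M"
    and small: "\<And>J h. J \<in> Pow I - {{}} \<Longrightarrow> h \<in> Cc (overlap J) \<Longrightarrow> (\<And>g. 0 \<le> h g) \<Longrightarrow> (\<And>g. h g \<le> 1) \<Longrightarrow>
      state \<xi> (pushforward t (overlap J) (\<lambda>g. h g * defect f J g)) \<le> \<epsilon>"
    and \<delta>: "0 < \<delta>"
  shows "(\<Sum>i\<in>I. state \<xi> (pushforward t (U i) (\<lambda>g. cmod (f i g)))) \<le>
    M + \<delta> + real (card (Pow I - {{}})) * \<epsilon>"
proof -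
  interpret t: etale_map t "gunits G"
    by (rule t)
  let ?P = "Pow I - {{}}"
  let ?F = "\<lambda>x. \<Sum>i\<in>I. pushforward t (U i) (\<lambda>g. cmod (f i g)) x"
  have finP: "finite ?P"
    using finite_index by simp
  have M0: "0 \<le> M"
    using M[of "{}"] by simp
  have p: "pushforward t (U i) (\<lambda>g. cmod (f i g)) \<in> Cc (gunits G)" if "i \<in> I" for i
    using that bisection_cover[OF that] inj decompositions_coordinates[OF f that]
    by (intro t.pushforward_Cc coordinates_norm_Cc) (auto simp: bisection_def)
  then have F: "?F \<in> Cc (gunits G)"
    by (rule Cc_sum)
  have oV: "open (overlap J)" if "J \<in> ?P" for J
    using overlap_bisection[OF that] by (simp add: bisection_def)
  have injV: "inj_on t (overlap J)" if J: "J \<in> ?P" for J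
  proof -
    obtain j where "j \<in> J" "j \<in> I"
      using J by blast
    then show ?thesis
      using inj[of j] by (auto simp: overlap_def intro: inj_on_subset)
  qed
  have cD: "continuous_on (overlap J) (defect f J)" if "J \<in> ?P" for J
    using overlap_continuous(3)[OF f] that by blast
  have bound: "?F x \<le> M + (\<Sum>J\<in>?P. pushforward t (overlap J) (defect f J) x)" for x
    unfolding overlap_def defect_def
  proof (rule finite_fibre_sum_le[OF finite_index inj])
    show "f i g = 0" if "i \<in> I" "g \<notin> U i" for i g
      using decompositions_coordinates[OF f that(1)] that(2) coordinates_outside by blast
    show "(\<Sum>g\<in>B. cmod (\<Sum>i\<in>I. f i g)) \<le> M" if "finite B" "B \<subseteq> {g. t g = x}" for B
      using M[OF that] f by (simp add: decompositions_def)
  qed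
  obtain h where h: "\<And>J. J \<in> ?P \<Longrightarrow> h J \<in> Cc (overlap J)" "\<And>J g. 0 \<le> h J g" "\<And>J g. h J g \<le> 1"
      "\<And>x. ?F x \<le> M + \<delta> + (\<Sum>J\<in>?P. pushforward t (overlap J) (\<lambda>g. h J g * defect f J g) x)"
    by (rule t.Cc_cutoff_approximation[OF finP oV injV cD defect_nonneg F bound M0 \<delta>]) blast+
  let ?b = "\<lambda>x. \<Sum>J\<in>?P. pushforward t (overlap J) (\<lambda>g. h J g * defect f J g) x"
  have q: "pushforward t (overlap J) (\<lambda>g. h J g * defect f J g) \<in> Cc (gunits G)" if "J \<in> ?P" for J
    by (intro t.pushforward_Cc oV injV Cc_mult_continuous cD h(1) that)
  then have b: "?b \<in> Cc (gunits G)"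
    by (rule Cc_sum)
  \<comment> \<open>\<open>?F - ?b\<close> is at most \<open>M + \<delta>\<close> everywhere, so the
    norm bound for states applies to it, while \<open>?b\<close> is handled by
    \<open>small\<close>.\<close>
  have "state \<xi> ?F = state \<xi> (\<lambda>x. ?F x - ?b x) + state \<xi> ?b"
    by (simp add: state_diff[OF F b])
  also have "state \<xi> (\<lambda>x. ?F x - ?b x) \<le> (M + \<delta>) * (ip_norm ip \<xi>)\<^sup>2"
    by (rule state_le[OF Cc_diff[OF F b]]) (use h(4) M0 \<delta> in \<open>auto simp: algebra_simps\<close>)
  also have "\<dots> \<le> (M + \<delta>) * 1"
    using \<xi> M0 \<delta> ip_norm_nonneg[of \<xi>] by (intro mult_left_mono power_le_one) auto
  also have "state \<xi> ?b = (\<Sum>J\<in>?P. state \<xi> (pushforward t (overlap J) (\<lambda>g. h J g * defect f J g)))"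
    by (rule state_sum[OF q])
  also have "\<dots> \<le> real (card ?P) * \<epsilon>"
    by (rule sum_bounded_above) (intro small h, auto)
  finally show ?thesis
    by (simp add: state_sum[OF p])
qed

text \<open>The order of choices matters. The number of overlaps depends on \<open>I\<close> alone,
  so \<epsilon> can be fixed first; the cutoffs depend on the near-minimiser \<open>f\<close>, so
  smallness of the defects is proved uniformly in the cutoff.\<close>

lemma cmod_ip_rep_le_fibre_bound:
  assumes f0: "f0 \<in> decompositions F"
    and Ms: "\<And>x B. finite B \<Longrightarrow> B \<subseteq> {g. src G g = x} \<Longrightarrow> (\<Sum>g\<in>B. cmod (F g)) \<le> M"
    and Mr: "\<And>x B. finite B \<Longrightarrow> B \<subseteq> {g. rng G g = x} \<Longrightarrow> (\<Sum>g\<in>B. cmod (F g)) \<le> M"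
    and \<xi>: "ip_norm ip \<xi> \<le> 1" and \<zeta>: "ip_norm ip \<zeta> \<le> 1"
  shows "cmod (ip (\<pi> (sec F) \<xi>) \<zeta>) \<le> M"
proof (rule field_le_epsilon)
  fix e :: real assume e: "0 < e"
  let ?P = "Pow I - {{}}"
  define N where "N = real (card ?P)"
  \<comment> \<open>Chosen so that the errors of all \<open>N\<close> overlaps stay below
    \<open>e / 2\<close>; the other half of \<open>e\<close> pays for the cutoffs. The
    \<open>+ 1\<close> covers an empty \<open>I\<close>, where \<open>N = 0\<close>.\<close>
  define \<epsilon> where "\<epsilon> = e / (2 * (N + 1))"
  have N: "0 \<le> N"
    by (simp add: N_def)
  have \<epsilon>: "0 < \<epsilon>" "N * \<epsilon> \<le> e / 2"
    using e N by (simp_all add: \<epsilon>_def field_simps)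
  let ?\<Phi> = "total_cost \<xi> \<zeta>"
  have \<Phi>: "0 \<le> ?\<Phi> f" if "f \<in> decompositions F" for f
    unfolding total_cost_def using that decompositions_coordinates
    by (intro sum_nonneg cost_nonneg bisection_cover coordinates_norm_Cc) auto
  have bdd: "bdd_below (?\<Phi> ` decompositions F)"
    using \<Phi> by (intro bdd_belowI2[of _ 0])
  obtain f where f: "f \<in> decompositions F" "?\<Phi> f < Inf (?\<Phi> ` decompositions F) + \<epsilon>"
    using cInf_lessD[of "?\<Phi> ` decompositions F" "Inf (?\<Phi> ` decompositions F) + \<epsilon>"] f0 \<epsilon>(1) by auto
  have min: "?\<Phi> f \<le> ?\<Phi> f' + \<epsilon>" if "f' \<in> decompositions F" for f'
    using f(2) cInf_lower[OF imageI[OF that] bdd] by simp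
  \<comment> \<open>By near-minimality a transfer saves at most \<epsilon>. The saving is a sum of
    two nonnegative states, so each is at most \<epsilon>.\<close>
  have small: "state \<xi> (pushforward (src G) (overlap J) (\<lambda>g. h g * defect f J g)) \<le> \<epsilon> \<and>
      state \<zeta> (pushforward (rng G) (overlap J) (\<lambda>g. h g * defect f J g)) \<le> \<epsilon>"
    if J: "J \<in> ?P" and h: "h \<in> Cc (overlap J)" "\<And>g. 0 \<le> h g" "\<And>g. h g \<le> 1" for J h
  proof -
    obtain f' where f': "f' \<in> decompositions F"
        "?\<Phi> f' \<le> ?\<Phi> f - cost \<xi> \<zeta> (overlap J) (\<lambda>g. h g * defect f J g)"
      using transfer[OF f(1) J h] .
    have hD: "(\<lambda>g. h g * defect f J g) \<in> Cc (overlap J)"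
      using J by (intro Cc_mult_continuous(1)[OF h(1)] overlap_continuous(3)[OF f(1)]) auto
    have nonneg: "0 \<le> pushforward t (overlap J) (\<lambda>g. h g * defect f J g) x" for t :: "'g \<Rightarrow> 'g" and x
      by (intro pushforward_nonneg mult_nonneg_nonneg h defect_nonneg)
    note p = bisection_pushforward_Cc[OF overlap_bisection[OF J] hD]
    have "0 \<le> state \<xi> (pushforward (src G) (overlap J) (\<lambda>g. h g * defect f J g))"
      by (rule state_nonneg[OF p(1) nonneg])
    moreover have "0 \<le> state \<zeta> (pushforward (rng G) (overlap J) (\<lambda>g. h g * defect f J g))"
      by (rule state_nonneg[OF p(2) nonneg])
    moreover have "cost \<xi> \<zeta> (overlap J) (\<lambda>g. h g * defect f J g) \<le> \<epsilon>"
      using f'(2) min[OF f'(1)] by simp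
    ultimately show ?thesis
      unfolding cost_def by simp
  qed
  have s: "(\<Sum>i\<in>I. state \<xi> (pushforward (src G) (U i) (\<lambda>g. cmod (f i g)))) \<le> M + e / 2 + N * \<epsilon>"
    unfolding N_def
    by (rule state_pushforward_sum_le[OF src.etale_map_axioms _ f(1) \<xi> Ms])
       (use bisection_cover small e in \<open>auto simp: bisection_def\<close>)
  have r: "(\<Sum>i\<in>I. state \<zeta> (pushforward (rng G) (U i) (\<lambda>g. cmod (f i g)))) \<le> M + e / 2 + N * \<epsilon>"
    unfolding N_def
    by (rule state_pushforward_sum_le[OF rng.etale_map_axioms _ f(1) \<zeta> Mr])
       (use bisection_cover small e in \<open>auto simp: bisection_def\<close>)
  have F: "F = (\<lambda>g. \<Sum>i\<in>I. f i g)"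
    using f(1) by (auto simp: decompositions_def)
  have \<Gamma>: "sec (f i) \<in> Gamma_c L" if "i \<in> I" for i
    using bisection_cover[OF that] bisection_Hausdorff decompositions_coordinates[OF f(1) that]
    by (intro sec_in_Gamma_c[of "U i"]) (auto simp: bisection_def)
  have "ip (\<pi> (sec F) \<xi>) \<zeta> = (\<Sum>i\<in>I. ip (\<pi> (sec (f i)) \<xi>) \<zeta>)"
    unfolding F using rep_sec_sum[OF finite_index \<Gamma>] by (simp add: ip_sum_left)
  also have "cmod \<dots> \<le> (\<Sum>i\<in>I. cmod (ip (\<pi> (sec (f i)) \<xi>) \<zeta>))"
    by (rule norm_sum)
  also have "\<dots> \<le> (\<Sum>i\<in>I. (state \<xi> (pushforward (src G) (U i) (\<lambda>g. cmod (f i g))) +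
      state \<zeta> (pushforward (rng G) (U i) (\<lambda>g. cmod (f i g)))) / 2)"
    by (intro sum_mono cmod_ip_rep_le bisection_cover decompositions_coordinates[OF f(1)])
  also have "\<dots> \<le> M + e / 2 + N * \<epsilon>"
    using s r by (simp add: sum.distrib flip: sum_divide_distrib)
  also have "\<dots> \<le> M + e"
    using \<epsilon>(2) by simp
  finally show "cmod (ip (\<pi> (sec F) \<xi>) \<zeta>) \<le> M + e" .
qed

end

section \<open>Comparison with the I-norm\<close>

lemma finite_sum_le_I_norm:
  assumes "finite B" "x \<in> gunits G" "B \<subseteq> {g. src G g = x} \<or> B \<subseteq> {g. rng G g = x}"
  shows "(\<Sum>g\<in>B. ennreal (lnorm L (\<eta> g))) \<le> I_norm G L \<eta>"
proof -
  have le: "(\<Sum>g\<in>B. ennreal (lnorm L (\<eta> g))) \<le> (\<Sum>\<^sub>\<infinity>g\<in>A. ennreal (lnorm L (\<eta> g)))" if "B \<subseteq> A" for A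
    by (subst nonneg_infsum_complete) (use assms(1) that in \<open>auto intro!: SUP_upper\<close>)
  show ?thesis
    using assms(3)
  proof
    assume "B \<subseteq> {g. src G g = x}"
    from le[OF this] show ?thesis
      unfolding I_norm_def
      by (rule order_trans) (intro max.coboundedI1 SUP_upper assms(2))
  next
    assume "B \<subseteq> {g. rng G g = x}"
    from le[OF this] show ?thesis
      unfolding I_norm_def
      by (rule order_trans) (intro max.coboundedI2 SUP_upper assms(2))
  qed
qed

context Gamma_c_representation
begin

lemma cmod_ip_rep_le_I_norm:
  assumes \<eta>: "\<eta> \<in> Gamma_c L" and M: "I_norm G L \<eta> = ennreal M" "0 \<le> M"
    and \<xi>: "ip_norm ip \<xi> \<le> 1" and \<zeta>: "ip_norm ip \<zeta> \<le> 1"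
  shows "cmod (ip (\<pi> \<eta> \<xi>) \<zeta>) \<le> M"
proof -
  obtain F where F: "F \<in> bisection_span" "\<eta> = sec F"
    using Gamma_c_bisection_span[OF \<eta>] .
  obtain n :: nat and U f where U: "\<And>i. i < n \<Longrightarrow> bisection G (U i)"
      "\<And>i. i < n \<Longrightarrow> f i \<in> coordinates (U i)" "F = (\<lambda>g. \<Sum>i<n. f i g)"
    using bisection_span_finite_sum[OF F(1)] by metis
  interpret bisection_cover G L scaleC ip \<pi> "{..<n}" U
    by unfold_locales (use U in auto)
  have bound: "(\<Sum>g\<in>B. cmod (F g)) \<le> M"
    if B: "finite B" "B \<subseteq> {g. src G g = x} \<or> B \<subseteq> {g. rng G g = x}" for x B
  \<comment> \<open>The suprema in \<open>I_norm\<close> run over units; over any other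
    \<open>x\<close> both fibres are empty.\<close>
  proof (cases "x \<in> gunits G")
    case True
    have "ennreal (\<Sum>g\<in>B. cmod (F g)) \<le> ennreal M"
      using finite_sum_le_I_norm[OF B(1) True B(2), of L \<eta>] M(1) by (simp add: F(2) lnorm_sec)
    then show ?thesis
      using M(2) by (simp add: ennreal_le_iff)
  next
    case False
    then have "B = {}"
      using B(2) src_in_gunits rng_in_gunits by blast
    then show ?thesis
      using M(2) by simp
  qed
  have "f \<in> decompositions F"
    using U by (simp add: decompositions_def)
  then show ?thesis
    unfolding F(2) by (rule cmod_ip_rep_le_fibre_bound) (use bound \<xi> \<zeta> in blast)+
qed

lemma op_norm_rep_le_I_norm:
  assumes \<eta>: "\<eta> \<in> Gamma_c L"
  shows "op_norm ip (\<pi> \<eta>) \<le> I_norm G L \<eta>"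
proof (cases "I_norm G L \<eta>" rule: ennreal_cases)
  case (real M)
  have "ip_norm ip (\<pi> \<eta> \<xi>) \<le> M" if \<xi>: "ip_norm ip \<xi> \<le> 1" for \<xi>
  proof (cases "ip_norm ip (\<pi> \<eta> \<xi>) = 0")
    case True
    then show ?thesis
      using real by simp
  next
    case False
    define r where "r = ip_norm ip (\<pi> \<eta> \<xi>)"
    have r: "0 < r"
      using False ip_norm_nonneg[of "\<pi> \<eta> \<xi>"] by (simp add: r_def)
    \<comment> \<open>Pairing with the normalised image recovers its norm as an inner
      product.\<close>
    define \<zeta> where "\<zeta> = scaleC (complex_of_real (1 / r)) (\<pi> \<eta> \<xi>)"
    have self: "ip (\<pi> \<eta> \<xi>) (\<pi> \<eta> \<xi>) = complex_of_real (r\<^sup>2)"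
      unfolding r_def by (rule ip_self)
    have "ip \<zeta> \<zeta> = 1"
      using r by (simp add: \<zeta>_def ip_scale_left ip_scale_right self power2_eq_square)
    then have "ip_norm ip \<zeta> \<le> 1"
      by (simp add: ip_norm_def)
    from cmod_ip_rep_le_I_norm[OF \<eta> real(2,1) \<xi> this]
    have "cmod (ip (\<pi> \<eta> \<xi>) \<zeta>) \<le> M" .
    moreover have "ip (\<pi> \<eta> \<xi>) \<zeta> = complex_of_real r"
      using r by (simp add: \<zeta>_def ip_scale_right self power2_eq_square)
    ultimately show ?thesis
      using r by (simp add: r_def)
  qed
  then show ?thesis
    unfolding op_norm_def real(2) by (intro SUP_least ennreal_leI) simp
qed simp

end

theorem proposition3p1:
  fixes G :: "'g::topological_space groupoid_struct"
    and L :: "('g, 'l::topological_space) fell_bundle_struct"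
    and scaleC :: "complex \<Rightarrow> 'h::ab_group_add \<Rightarrow> 'h"
    and ip :: "'h \<Rightarrow> 'h \<Rightarrow> complex"
    and \<pi> :: "('g \<Rightarrow> 'l) \<Rightarrow> 'h \<Rightarrow> 'h"
    and \<eta> :: "'g \<Rightarrow> 'l"
  assumes "locally_compact_etale_groupoid G"
    and "fell_line_bundle G L"
    and "pre_hilbert_space scaleC ip"
    and "Gamma_c_representation G L scaleC ip \<pi>"
    and "\<eta> \<in> Gamma_c L"
  shows "op_norm ip (\<pi> \<eta>) \<le> I_norm G L \<eta>"
  using Gamma_c_representation.op_norm_rep_le_I_norm assms(4,5) .

end
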